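(* Let $\mathcal I$ be a countable instance over a finite signature of arbitrary arity. Then: (1) if $\mathcal I$ has finite treewidth, then $\mathcal I$ has finite partitionwidth; (2) if $\mathcal I$ has finite cliquewidth, then $\mathcal I$ has finite partitionwidth.
   Context: Instances: for a finite signature $\Sigma$ (relation symbols with arities $\ge1$, containing unary $\top$) and a finite set $\mathrm{Cnst}$ of constants, an instance is a countable set of atoms whose terms are constants or nulls; $\mathrm{adom}$ is its set of terms; isomorphism is a bijection of terms fixing constants mapping atoms onto atoms; $\mathrm{ar}(\Sigma)$ is the maximal arity. Treewidth: a tree decomposition of $\mathcal I$ is a (possibly infinite) tree whose nodes are subsets ("bags") of $\mathrm{adom}(\mathcal I)$ covering it, such that the terms of each atom lie in a common bag and for each term the bags containing it form a connected subtree; $\mathcal I$ has finite treewidth if some tree decomposition has bag sizes bounded by some $k\in\mathbb N$. Cliquewidth (countable version): $\mathcal I$ has finite cliquewidth if, for some finite set $K$ of unary colors, $\mathcal I$ is isomorphic to the instance generated by a (possibly infinite, non-well-founded) syntax tree on $\{0,1\}^*$ whose nodes carry exactly one of: $c_\kappa$ (create a $\kappa$-colored constant $c\in\mathrm{Cnst}$), $*_\kappa$ (create a $\kappa$-colored null, namely the node itself), $\oplus$ (disjoint union of the children's instances), $\mathrm{Recolor}_{\kappa\to\mu}$ (recolor all $\kappa$-colored terms of the child instance to $\mu$), $\mathrm{Add}_{R,\kappa_1,\dots,\kappa_n}$ (add to the child instance all atoms $R(t_1,\dots,t_n)$ with each $t_i$ colored $\kappa_i$), or $\mathrm{Void}$;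 nodes below creation nodes and unused children of unary operations are $\mathrm{Void}$, and each constant is created at most once. The generated instance consists of all atoms created anywhere plus $\top(t)$ for every created term $t$. Partitionwidth: let $\mathbb L$ be a finite set of colors, each with an arity $\mathrm{ar}(\lambda)\in\mathbb N_+$, containing distinguished colors $o_i$ of arity $i$ for $1\le i\le\mathrm{ar}(\Sigma)$. For a $k$-tuple $\vec a$, an $m$-tuple $\vec b$ and $I\subsetneq\{1,\dots,k+m\}$ with $|I|=k$, $\vec a\,{+}{+}_I\,\vec b$ is the $(k+m)$-tuple carrying $a_1,\dots,a_k$ (in order) at positions in $I$ and $b_1,\dots,b_m$ (in order) elsewhere; extended elementwise to sets. Instructions: $\mathrm{Add}(\kappa,\mu,I\to\lambda)$ ($\mathrm{ar}\kappa+\mathrm{ar}\mu=\mathrm{ar}\lambda$, $I\subsetneq\{1..\mathrm{ar}\lambda\}$, $|I|=\mathrm{ar}\kappa$); $\mathrm{Recol}^i(\kappa\to\lambda)$ ($i\in\{0,1\}$, equal arities); $\mathrm{RAdd}(\kappa,\mu,I\to R)$ ($R\in\Sigma$, $\mathrm{ar}\kappa+\mathrm{ar}\mu=\mathrm{ar}R$, $I\subsetneq\{1..\mathrm{ar}R\}$, $|I|=\mathrm{ar}\kappa$); $\mathrm{Mat}^i(\kappa\to R)$ ($\mathrm{ar}\kappa=\mathrm{ar}R$). Two Add (resp. two $\mathrm{Recol}^i$) instructions differing only in the target color are incompatible. A well-decorated tree labels each node $s\in\{0,1\}^*$ with a set of decorators from $\{*\}\cup\mathrm{Cnst}\cup\{\text{instructions}\}$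 so that: a node labeled $*$ or a constant (pseudoleaf) has no other label; proper descendants of pseudoleaves are unlabeled; each constant labels at most one node; no node carries incompatible instructions. Entities of $s$: nodes $ss'$ labeled $*$ and constants labeling some $ss'$. Recursively: at a pseudoleaf labeled $c$ (resp. $*$), $\mathrm{col}_s(o_i)=\{(c,\dots,c)\}$ (resp. $\{(s,\dots,s)\}$, length $i$), other colors empty; otherwise $\mathrm{col}_s(\lambda)$ is the union of $\mathrm{col}_{s0}(\kappa)\,{+}{+}_I\,\mathrm{col}_{s1}(\mu)$ over $\mathrm{Add}(\kappa,\mu,I\to\lambda)$ at $s$, of $\mathrm{col}_{si}(\kappa)$ over $\mathrm{Recol}^i(\kappa\to\lambda)$ at $s$, and for each $i$ of $\mathrm{col}_{si}(\lambda)$ unless some $\mathrm{Recol}^i(\lambda\to\kappa)$ is at $s$. $\mathrm{Atoms}_s$ is $\{\top(c)\}$ / $\{\top(s)\}$ at pseudoleaves, else all $R(\vec e)$ with $\vec e\in\mathrm{col}_{s0}(\kappa)\,{+}{+}_I\,\mathrm{col}_{s1}(\mu)$ for an $\mathrm{RAdd}(\kappa,\mu,I\to R)$ at $s$, or $\vec e\in\mathrm{col}_{si}(\kappa)$ for a $\mathrm{Mat}^i(\kappa\to R)$ at $s$. The represented instance is $\bigcup_s\mathrm{Atoms}_s$; $\mathcal I$ has finite partitionwidth if it is isomorphic to the instance represented by some well-decorated tree over some finite color set $\mathbb L$.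
   Formalization: Instances are additionally required to contain ⊤(t) for each of their terms t; without this, part (1) fails (e.g. the instance {R(a,b)}), since every instance represented by a well-decorated tree contains ⊤(t) for all its terms. *)

theory Defs
  imports "HOL-Library.Countable_Set"
begin

section \<open>Signatures and instances\<close>

record ('r, 'c) sig =
  rels :: "'r set"
  arity :: "'r \<Rightarrow> nat"
  univ :: 'r  \<comment> \<open>the symbol \<open>\<top>\<close>\<close>
  cnst :: "'c set"

definition wf_sig :: "('r, 'c) sig \<Rightarrow> bool" where
  "wf_sig Sg \<longleftrightarrow>
     finite (rels Sg) \<and> finite (cnst Sg) \<and> (\<forall>R\<in>rels Sg. 1 \<le> arity Sg R) \<and>
     univ Sg \<in> rels Sg \<and> arity Sg (univ Sg) = 1"

definition max_arity :: "('r, 'c) sig \<Rightarrow> nat" where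
  "max_arity Sg = Max (arity Sg ` rels Sg)"

datatype ('c, 'n) trm = Const 'c | Null 'n

type_synonym ('r, 'c, 'n) atm = "'r \<times> ('c, 'n) trm list"

definition adom :: "('r, 'c, 'n) atm set \<Rightarrow> ('c, 'n) trm set" where
  "adom \<I> = (\<Union>(R, ts)\<in>\<I>. set ts)"

text \<open>
  The symbol \<open>\<top>\<close> is the universal predicate: an instance contains \<open>\<top>(t)\<close> for each of its terms
  \<open>t\<close>.  This is automatic for the instances generated by the trees below.
\<close>

definition is_instance :: "('r, 'c) sig \<Rightarrow> ('r, 'c, 'n) atm set \<Rightarrow> bool" where
  "is_instance Sg \<I> \<longleftrightarrow>
     countable \<I> \<and>
     (\<forall>(R, ts)\<in>\<I>. R \<in> rels Sg \<and> length ts = arity Sg R) \<and>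
     (\<forall>c. Const c \<in> adom \<I> \<longrightarrow> c \<in> cnst Sg) \<and>
     (\<forall>t\<in>adom \<I>. (univ Sg, [t]) \<in> \<I>)"

text \<open>
  The two instances may use different types of nulls.  Both the bijection and its inverse fix
  constants, so nulls correspond to nulls.
\<close>

definition isomorphic :: "('r, 'c, 'n) atm set \<Rightarrow> ('r, 'c, 'm) atm set \<Rightarrow> bool" where
  "isomorphic \<I> \<J> \<longleftrightarrow>
     (\<exists>h. bij_betw h (adom \<I>) (adom \<J>) \<and>
          (\<forall>t\<in>adom \<I>. \<forall>c. h t = Const c \<longleftrightarrow> t = Const c) \<and>
          (\<lambda>(R, ts). (R, map h ts)) ` \<I> = \<J>)"


section \<open>Treewidth\<close>

text \<open>Undirected simple graphs are given by a vertex set and a symmetric, irreflexive edge relation.\<close>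

definition is_cycle :: "('v \<times> 'v) set \<Rightarrow> 'v list \<Rightarrow> bool" where
  "is_cycle E vs \<longleftrightarrow>
     3 \<le> length vs \<and> distinct vs \<and> successively (\<lambda>u v. (u, v) \<in> E) vs \<and> (last vs, hd vs) \<in> E"

definition induced_connected :: "('v \<times> 'v) set \<Rightarrow> 'v set \<Rightarrow> bool" where
  "induced_connected E W \<longleftrightarrow> (\<forall>u\<in>W. \<forall>v\<in>W. (u, v) \<in> (E \<inter> W \<times> W)\<^sup>*)"

definition is_tree :: "'v set \<Rightarrow> ('v \<times> 'v) set \<Rightarrow> bool" where
  "is_tree V E \<longleftrightarrow>
     V \<noteq> {} \<and> E \<subseteq> V \<times> V \<and> sym E \<and> irrefl E \<and>
     induced_connected E V \<and> (\<nexists>vs. is_cycle E vs)"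

definition tree_decomposition ::
  "('r, 'c, 'n) atm set \<Rightarrow> ('c, 'n) trm set set \<Rightarrow>
   (('c, 'n) trm set \<times> ('c, 'n) trm set) set \<Rightarrow> bool" where
  "tree_decomposition \<I> V E \<longleftrightarrow>
     is_tree V E \<and> \<Union>V = adom \<I> \<and>
     (\<forall>(R, ts)\<in>\<I>. \<exists>X\<in>V. set ts \<subseteq> X) \<and>
     (\<forall>t\<in>adom \<I>. induced_connected E {X \<in> V. t \<in> X})"

definition finite_treewidth :: "('r, 'c, 'n) atm set \<Rightarrow> bool" where
  "finite_treewidth \<I> \<longleftrightarrow>
     (\<exists>V E. tree_decomposition \<I> V E \<and> (\<exists>k. \<forall>X\<in>V. finite X \<and> card X \<le> k))"


section \<open>Nodes of the infinite binary tree\<close>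

text \<open>
  Nodes are words over \<open>{0,1}\<close>, with \<open>False\<close> for \<open>0\<close> and \<open>True\<close> for \<open>1\<close>; the children of \<open>s\<close> are
  \<open>s @ [False]\<close> and \<open>s @ [True]\<close>, its proper descendants are \<open>s @ u\<close> with \<open>u \<noteq> []\<close>.
  Nodes are also the nulls of the generated instances.
\<close>

type_synonym node = "bool list"


section \<open>Cliquewidth\<close>

datatype ('r, 'c, 'k) cw_op =
    CreateConst 'c 'k
  | CreateNull 'k
  | Oplus
  | Recolor 'k 'k
  | AddAtoms 'r "'k list"
  | Void

text \<open>Unary operations use the child \<open>s @ [False]\<close>. Nothing lives below a \<open>Void\<close> node.\<close>

definition cw_tree :: "('r, 'c) sig \<Rightarrow> 'k set \<Rightarrow> (node \<Rightarrow> ('r, 'c, 'k) cw_op) \<Rightarrow> bool" where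
  "cw_tree Sg K T \<longleftrightarrow>
     (\<forall>s. case T s of
        CreateConst c \<kappa> \<Rightarrow> c \<in> cnst Sg \<and> \<kappa> \<in> K \<and> (\<forall>u. u \<noteq> [] \<longrightarrow> T (s @ u) = Void)
      | CreateNull \<kappa> \<Rightarrow> \<kappa> \<in> K \<and> (\<forall>u. u \<noteq> [] \<longrightarrow> T (s @ u) = Void)
      | Oplus \<Rightarrow> True
      | Recolor \<kappa> \<mu> \<Rightarrow> \<kappa> \<in> K \<and> \<mu> \<in> K \<and> T (s @ [True]) = Void
      | AddAtoms R \<kappa>s \<Rightarrow>
          R \<in> rels Sg \<and> length \<kappa>s = arity Sg R \<and> set \<kappa>s \<subseteq> K \<and> T (s @ [True]) = Void
      | Void \<Rightarrow> (\<forall>u. T (s @ u) = Void)) \<and>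
     (\<forall>s s' c \<kappa> \<kappa>'. T s = CreateConst c \<kappa> \<and> T s' = CreateConst c \<kappa>' \<longrightarrow> s = s')"

text \<open>
  \<open>cw_col T s t \<kappa>\<close>: the term \<open>t\<close>, created at or below \<open>s\<close>, has color \<open>\<kappa>\<close> in the instance
  generated at \<open>s\<close>.
\<close>

inductive cw_col :: "(node \<Rightarrow> ('r, 'c, 'k) cw_op) \<Rightarrow> node \<Rightarrow> ('c, node) trm \<Rightarrow> 'k \<Rightarrow> bool"
  for T where
  "T s = CreateConst c \<kappa> \<Longrightarrow> cw_col T s (Const c) \<kappa>"
| "T s = CreateNull \<kappa> \<Longrightarrow> cw_col T s (Null s) \<kappa>"
| "T s = Oplus \<Longrightarrow> cw_col T (s @ [i]) t \<kappa> \<Longrightarrow> cw_col T s t \<kappa>"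
| "T s = Recolor \<kappa> \<mu> \<Longrightarrow> cw_col T (s @ [False]) t \<nu> \<Longrightarrow>
     cw_col T s t (if \<nu> = \<kappa> then \<mu> else \<nu>)"
| "T s = AddAtoms R \<kappa>s \<Longrightarrow> cw_col T (s @ [False]) t \<kappa> \<Longrightarrow> cw_col T s t \<kappa>"

definition cw_instance ::
  "('r, 'c) sig \<Rightarrow> (node \<Rightarrow> ('r, 'c, 'k) cw_op) \<Rightarrow> ('r, 'c, node) atm set" where
  "cw_instance Sg T =
     {(R, ts) | R ts. \<exists>s \<kappa>s. T s = AddAtoms R \<kappa>s \<and> list_all2 (cw_col T (s @ [False])) ts \<kappa>s}
     \<union> {(univ Sg, [Const c]) | c. \<exists>s \<kappa>. T s = CreateConst c \<kappa>}
     \<union> {(univ Sg, [Null s]) | s. \<exists>\<kappa>. T s = CreateNull \<kappa>}"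

text \<open>Finite sets of colors are, without loss of generality, finite sets of natural numbers.\<close>

definition finite_cliquewidth :: "('r, 'c) sig \<Rightarrow> ('r, 'c, 'n) atm set \<Rightarrow> bool" where
  "finite_cliquewidth Sg \<I> \<longleftrightarrow>
     (\<exists>(K :: nat set) T. finite K \<and> cw_tree Sg K T \<and> isomorphic \<I> (cw_instance Sg T))"


section \<open>Partitionwidth\<close>

text \<open>The field \<open>origin\<close> maps \<open>i\<close> to the distinguished color \<open>o\<^sub>i\<close>.\<close>

record 'l palette =
  colors :: "'l set"
  col_arity :: "'l \<Rightarrow> nat"
  origin :: "nat \<Rightarrow> 'l"

definition wf_palette :: "('r, 'c) sig \<Rightarrow> 'l palette \<Rightarrow> bool" where
  "wf_palette Sg P \<longleftrightarrow>
     finite (colors P) \<and> (\<forall>l\<in>colors P. 1 \<le> col_arity P l) \<and>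
     (\<forall>i\<in>{1..max_arity Sg}. origin P i \<in> colors P \<and> col_arity P (origin P i) = i)"

text \<open>
  \<open>interleave I as bs\<close> is \<open>as ++\<^sub>I bs\<close>; positions in \<open>I\<close> count from \<open>1\<close>, list indices from \<open>0\<close>.
\<close>

definition interleave :: "nat set \<Rightarrow> 'a list \<Rightarrow> 'a list \<Rightarrow> 'a list" where
  "interleave I as bs =
     map (\<lambda>j. if j \<in> I then as ! card (I \<inter> {1..<j}) else bs ! card ({1..<j} - I))
       [1..<length as + length bs + 1]"

definition interleave_sets :: "nat set \<Rightarrow> 'a list set \<Rightarrow> 'a list set \<Rightarrow> 'a list set" where
  "interleave_sets I A B = {interleave I as bs | as bs. as \<in> A \<and> bs \<in> B}"

datatype ('r, 'c, 'l) decorator =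
    StarD
  | ConstD 'c
  | Add 'l 'l "nat set" 'l
  | Recol bool 'l 'l
  | RAdd 'l 'l "nat set" 'r
  | Mat bool 'l 'r

fun wf_decorator :: "('r, 'c) sig \<Rightarrow> 'l palette \<Rightarrow> ('r, 'c, 'l) decorator \<Rightarrow> bool" where
  "wf_decorator Sg P StarD \<longleftrightarrow> True"
| "wf_decorator Sg P (ConstD c) \<longleftrightarrow> c \<in> cnst Sg"
| "wf_decorator Sg P (Add \<kappa> \<mu> I l) \<longleftrightarrow>
     \<kappa> \<in> colors P \<and> \<mu> \<in> colors P \<and> l \<in> colors P \<and>
     col_arity P \<kappa> + col_arity P \<mu> = col_arity P l \<and>
     I \<subset> {1..col_arity P l} \<and> card I = col_arity P \<kappa>"
| "wf_decorator Sg P (Recol i \<kappa> l) \<longleftrightarrow>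
     \<kappa> \<in> colors P \<and> l \<in> colors P \<and> col_arity P \<kappa> = col_arity P l"
| "wf_decorator Sg P (RAdd \<kappa> \<mu> I R) \<longleftrightarrow>
     \<kappa> \<in> colors P \<and> \<mu> \<in> colors P \<and> R \<in> rels Sg \<and>
     col_arity P \<kappa> + col_arity P \<mu> = arity Sg R \<and>
     I \<subset> {1..arity Sg R} \<and> card I = col_arity P \<kappa>"
| "wf_decorator Sg P (Mat i \<kappa> R) \<longleftrightarrow>
     \<kappa> \<in> colors P \<and> R \<in> rels Sg \<and> col_arity P \<kappa> = arity Sg R"

type_synonym ('r, 'c, 'l) dec_tree = "node \<Rightarrow> ('r, 'c, 'l) decorator set"

definition pseudoleaf :: "('r, 'c, 'l) dec_tree \<Rightarrow> node \<Rightarrow> bool" where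
  "pseudoleaf T s \<longleftrightarrow> StarD \<in> T s \<or> (\<exists>c. ConstD c \<in> T s)"

definition incompatible :: "('r, 'c, 'l) decorator \<Rightarrow> ('r, 'c, 'l) decorator \<Rightarrow> bool" where
  "incompatible d d' \<longleftrightarrow>
     (\<exists>\<kappa> \<mu> I l l'. d = Add \<kappa> \<mu> I l \<and> d' = Add \<kappa> \<mu> I l' \<and> l \<noteq> l') \<or>
     (\<exists>i \<kappa> l l'. d = Recol i \<kappa> l \<and> d' = Recol i \<kappa> l' \<and> l \<noteq> l')"

definition well_decorated ::
  "('r, 'c) sig \<Rightarrow> 'l palette \<Rightarrow> ('r, 'c, 'l) dec_tree \<Rightarrow> bool" where
  "well_decorated Sg P T \<longleftrightarrow>
     (\<forall>s. \<forall>d\<in>T s. wf_decorator Sg P d) \<and>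
     (\<forall>s. StarD \<in> T s \<longrightarrow> T s = {StarD}) \<and>
     (\<forall>s c. ConstD c \<in> T s \<longrightarrow> T s = {ConstD c}) \<and>
     (\<forall>s u. pseudoleaf T s \<and> u \<noteq> [] \<longrightarrow> T (s @ u) = {}) \<and>
     (\<forall>s s' c. ConstD c \<in> T s \<and> ConstD c \<in> T s' \<longrightarrow> s = s') \<and>
     (\<forall>s. \<forall>d\<in>T s. \<forall>d'\<in>T s. \<not> incompatible d d')"

text \<open>
  \<open>pw_col Sg P T s l\<close> is \<open>col\<^sub>s(l)\<close>.  The recursion descends an infinite tree, so it is read
  as a least fixed point: only tuples built up from pseudoleaves at or below \<open>s\<close> belong to it.
\<close>

inductive_set pw_colp ::
  "('r, 'c) sig \<Rightarrow> 'l palette \<Rightarrow> ('r, 'c, 'l) dec_tree \<Rightarrow> (node \<times> 'l \<times> ('c, node) trm list) set"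
  for Sg P T where
  "ConstD c \<in> T s \<Longrightarrow> i \<in> {1..max_arity Sg} \<Longrightarrow>
     (s, origin P i, replicate i (Const c)) \<in> pw_colp Sg P T"
| "StarD \<in> T s \<Longrightarrow> i \<in> {1..max_arity Sg} \<Longrightarrow>
     (s, origin P i, replicate i (Null s)) \<in> pw_colp Sg P T"
| "\<not> pseudoleaf T s \<Longrightarrow> Add \<kappa> \<mu> I l \<in> T s \<Longrightarrow>
     (s @ [False], \<kappa>, as) \<in> pw_colp Sg P T \<Longrightarrow> (s @ [True], \<mu>, bs) \<in> pw_colp Sg P T \<Longrightarrow>
     (s, l, interleave I as bs) \<in> pw_colp Sg P T"
| "\<not> pseudoleaf T s \<Longrightarrow> Recol i \<kappa> l \<in> T s \<Longrightarrow>
     (s @ [i], \<kappa>, as) \<in> pw_colp Sg P T \<Longrightarrow> (s, l, as) \<in> pw_colp Sg P T"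
| "\<not> pseudoleaf T s \<Longrightarrow> \<nexists>\<kappa>. Recol i l \<kappa> \<in> T s \<Longrightarrow>
     (s @ [i], l, as) \<in> pw_colp Sg P T \<Longrightarrow> (s, l, as) \<in> pw_colp Sg P T"

definition pw_col ::
  "('r, 'c) sig \<Rightarrow> 'l palette \<Rightarrow> ('r, 'c, 'l) dec_tree \<Rightarrow> node \<Rightarrow> 'l \<Rightarrow> ('c, node) trm list set" where
  "pw_col Sg P T s l = {as. (s, l, as) \<in> pw_colp Sg P T}"

definition pw_atoms ::
  "('r, 'c) sig \<Rightarrow> 'l palette \<Rightarrow> ('r, 'c, 'l) dec_tree \<Rightarrow> node \<Rightarrow> ('r, 'c, node) atm set" where
  "pw_atoms Sg P T s =
     (if pseudoleaf T s
      then {(univ Sg, [Const c]) | c. ConstD c \<in> T s} \<union> (if StarD \<in> T s then {(univ Sg, [Null s])} else {})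
      else {(R, ts) | R ts. \<exists>\<kappa> \<mu> I. RAdd \<kappa> \<mu> I R \<in> T s \<and>
              ts \<in> interleave_sets I (pw_col Sg P T (s @ [False]) \<kappa>) (pw_col Sg P T (s @ [True]) \<mu>)}
         \<union> {(R, ts) | R ts. \<exists>i \<kappa>. Mat i \<kappa> R \<in> T s \<and> ts \<in> pw_col Sg P T (s @ [i]) \<kappa>})"

definition pw_instance ::
  "('r, 'c) sig \<Rightarrow> 'l palette \<Rightarrow> ('r, 'c, 'l) dec_tree \<Rightarrow> ('r, 'c, node) atm set" where
  "pw_instance Sg P T = (\<Union>s. pw_atoms Sg P T s)"

definition finite_partitionwidth :: "('r, 'c) sig \<Rightarrow> ('r, 'c, 'n) atm set \<Rightarrow> bool" where
  "finite_partitionwidth Sg \<I> \<longleftrightarrow>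
     (\<exists>(P :: nat palette) T.
        wf_palette Sg P \<and> well_decorated Sg P T \<and> isomorphic \<I> (pw_instance Sg P T))"

end

theory Submission
  imports Defs "HOL-Library.Sublist" "HOL-Library.Nat_Bijection"
begin

text \<open>
  Place the terms of an instance at the leaves of the binary tree and classify, at every node, the
  tuples of terms below it. If the number of classes is uniformly bounded, the class of a tuple at a
  node is determined by the classes of its parts at the two children, and membership in a relation
  can be read off a class at some node, then the classes are the colors of a well-decorated tree
  that uses only \<open>Add\<close>, \<open>Recol\<close> and \<open>Mat\<close>.

  For a cliquewidth tree, classify a tuple by the colors of its components. For a tree decomposition,
  classify a tuple by the atoms it forms together with terms outside the subtree. This is trivially
  compatible with the tree structure, so only the number of classes has to be bounded. Root the
  decomposition, attach every term \<open>t\<close> to an arbitrary bag containing it, and code the path from the root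
  to \<open>t\<close> as a binary word. Below a node of the binary tree there is then a union of some of the
  components left after the removal of a single bag, up to terms of that bag. Hence an atom
  that contains terms \<open>a\<close> below and \<open>z\<close> not below the node has \<open>a\<close> or \<open>z\<close> in the bag, and the class of
  a tuple is determined by its components in the bag and by its atoms with parameters in the bag.
\<close>

section \<open>Interleaving\<close>

lemma length_interleave [simp]: "length (interleave J as bs) = length as + length bs"
  by (auto simp: interleave_def simp del: upt_Suc)

lemma interleave_nth:
  assumes "j < length as + length bs"
  shows "interleave J as bs ! j =
    (if Suc j \<in> J then as ! card (J \<inter> {1..<Suc j}) else bs ! card ({1..<Suc j} - J))"
  using assms by (simp add: interleave_def del: upt_Suc)

text \<open>Position \<open>j\<close> itself is missing from \<open>J \<inter> {1..<j}\<close>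
  (respectively from \<open>{1..<j} - J\<close>), so the count is strictly below the number of
  available entries and the list access is in range.\<close>

lemma interleave_index:
  assumes J: "J \<subseteq> {1..length as + length bs}" "card J = length as"
    and j: "j \<in> {1..length as + length bs}"
  shows "j \<in> J \<Longrightarrow> card (J \<inter> {1..<j}) < length as"
    and "j \<notin> J \<Longrightarrow> card ({1..<j} - J) < length bs"
proof -
  have fin: "finite J" using J(1) finite_subset by blast
  show "card (J \<inter> {1..<j}) < length as" if "j \<in> J"
    using psubset_card_mono[OF fin, of "J \<inter> {1..<j}"] that J(2) by force
  show "card ({1..<j} - J) < length bs" if "j \<notin> J"
  proof -
    have "card ({1..length as + length bs} - J) = length bs"
      using J by (simp add: card_Diff_subset fin)
    moreover have "{1..<j} - J \<subset> {1..length as + length bs} - J" using that j by force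
    ultimately show ?thesis by (metis finite_Diff finite_atLeastAtMost psubset_card_mono)
  qed
qed

lemma map_interleave:
  assumes "J \<subseteq> {1..length as + length bs}" "card J = length as"
  shows "map g (interleave J as bs) = interleave J (map g as) (map g bs)"
  using interleave_index[OF assms] by (auto simp: interleave_def)

lemma set_interleave:
  assumes "J \<subseteq> {1..length as + length bs}" "card J = length as"
  shows "set (interleave J as bs) \<subseteq> set as \<union> set bs"
  using interleave_index[OF assms] by (auto simp: interleave_def)

text \<open>The elements that survive before position \<open>j\<close> are exactly those of the
  filtered prefix, so the next survivor is \<open>xs ! j\<close>.\<close>

lemma filter_nth_filter_take:
  assumes "j < length xs" "Q (xs ! j)"
  shows "filter Q xs ! length (filter Q (take j xs)) = xs ! j"
proof -
  have "filter Q xs = filter Q (take j xs) @ xs ! j # filter Q (drop (Suc j) xs)"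
    by (subst id_take_nth_drop[OF assms(1)]) (use assms(2) in simp)
  then show ?thesis by simp
qed

lemma length_filter_take:
  assumes "j \<le> length xs"
  shows "length (filter Q (take j xs)) = card {i \<in> {1..<Suc j}. Q (xs ! (i - 1))}"
proof -
  have "{i \<in> {1..<Suc j}. Q (xs ! (i - 1))} = Suc ` {i. i < j \<and> Q (xs ! i)}"
  proof (intro set_eqI iffI)
    fix i assume "i \<in> {i \<in> {1..<Suc j}. Q (xs ! (i - 1))}"
    then show "i \<in> Suc ` {i. i < j \<and> Q (xs ! i)}" by (cases i) auto
  qed auto
  moreover have "{i. i < length (take j xs) \<and> Q (take j xs ! i)} = {i. i < j \<and> Q (xs ! i)}"
    using assms by auto
  ultimately show ?thesis by (simp add: length_filter_conv_card card_image)
qed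

text \<open>This splits a tuple according to the child below which each component lies:
  \<open>J\<close> records the positions, and the two filtered parts keep their order.\<close>

lemma interleave_filter:
  fixes xs :: "'a list" and Q :: "'a \<Rightarrow> bool"
  defines "J \<equiv> {j \<in> {1..length xs}. Q (xs ! (j - 1))}"
  shows "interleave J (filter Q xs) (filter (\<lambda>x. \<not> Q x) xs) = xs" (is "?lhs = xs")
    and "card J = length (filter Q xs)"
    and "J \<subseteq> {1..length xs}"
proof -
  show "J \<subseteq> {1..length xs}" by (auto simp: J_def)
  show "card J = length (filter Q xs)"
    using length_filter_take[of "length xs" xs Q] by (simp add: J_def atLeastLessThanSuc_atLeastAtMost)
  have len: "length (filter Q xs) + length (filter (\<lambda>x. \<not> Q x) xs) = length xs"
    by (rule sum_length_filter_compl)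
  show "?lhs = xs"
  proof (rule nth_equalityI)
    show "length ?lhs = length xs" by (simp add: len)
    fix i assume "i < length ?lhs"
    then have i: "i < length xs" by (simp add: len)
    have 1: "J \<inter> {1..<Suc i} = {k \<in> {1..<Suc i}. Q (xs ! (k - 1))}"
      and 2: "{1..<Suc i} - J = {k \<in> {1..<Suc i}. \<not> Q (xs ! (k - 1))}"
      and 3: "Suc i \<in> J \<longleftrightarrow> Q (xs ! i)"
      using i by (auto simp: J_def)
    have "?lhs ! i = (if Suc i \<in> J then filter Q xs ! card (J \<inter> {1..<Suc i})
        else filter (\<lambda>x. \<not> Q x) xs ! card ({1..<Suc i} - J))"
      using i by (simp add: interleave_def len del: upt_Suc)
    then show "?lhs ! i = xs ! i"
      using i unfolding 1 2 3 length_filter_take[OF less_imp_le[OF i], of Q, symmetric]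
        length_filter_take[OF less_imp_le[OF i], of "\<lambda>x. \<not> Q x", symmetric]
      by (simp add: filter_nth_filter_take)
  qed
qed

section \<open>Isomorphisms\<close>

lemma adom_image: "adom ((\<lambda>(R, ts). (R, map h ts)) ` \<I>) = h ` adom \<I>"
  by (simp add: adom_def case_prod_unfold image_UN)

lemma isomorphic_trans:
  assumes "isomorphic \<I> \<J>" "isomorphic \<J> \<K>"
  shows "isomorphic \<I> \<K>"
proof -
  obtain g where g: "bij_betw g (adom \<I>) (adom \<J>)"
      "\<forall>t\<in>adom \<I>. \<forall>c. g t = Const c \<longleftrightarrow> t = Const c" "(\<lambda>(R, ts). (R, map g ts)) ` \<I> = \<J>"
    using assms(1) unfolding isomorphic_def by blast
  obtain h where h: "bij_betw h (adom \<J>) (adom \<K>)"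
      "\<forall>t\<in>adom \<J>. \<forall>c. h t = Const c \<longleftrightarrow> t = Const c" "(\<lambda>(R, ts). (R, map h ts)) ` \<J> = \<K>"
    using assms(2) unfolding isomorphic_def by blast
  have "bij_betw (h \<circ> g) (adom \<I>) (adom \<K>)" using g(1) h(1) by (rule bij_betw_trans)
  moreover have "\<forall>t\<in>adom \<I>. \<forall>c. (h \<circ> g) t = Const c \<longleftrightarrow> t = Const c"
    using g(1,2) h(2) by (metis bij_betwE comp_apply)
  moreover have "(\<lambda>(R, ts). (R, map (h \<circ> g) ts)) ` \<I> = \<K>"
    unfolding h(3)[symmetric] g(3)[symmetric] image_image by (simp add: case_prod_unfold)
  ultimately show ?thesis unfolding isomorphic_def by (intro exI[of _ "h \<circ> g"] conjI)
qed

lemma is_instance_isomorphic: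
  assumes "is_instance Sg \<I>" "isomorphic \<I> \<J>"
  shows "is_instance Sg \<J>"
proof -
  obtain h where h: "bij_betw h (adom \<I>) (adom \<J>)"
      "\<forall>t\<in>adom \<I>. \<forall>c. h t = Const c \<longleftrightarrow> t = Const c" "(\<lambda>(R, ts). (R, map h ts)) ` \<I> = \<J>"
    using assms(2) unfolding isomorphic_def by blast
  have dom: "adom \<J> = h ` adom \<I>" using h(1) by (simp add: bij_betw_def)
  have "countable \<J>" using assms(1) unfolding is_instance_def h(3)[symmetric] by simp
  moreover have "\<forall>(R, ts)\<in>\<J>. R \<in> rels Sg \<and> length ts = arity Sg R"
    using assms(1) unfolding is_instance_def h(3)[symmetric] by auto
  moreover have "\<forall>c. Const c \<in> adom \<J> \<longrightarrow> c \<in> cnst Sg"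
  proof (intro allI impI)
    fix c assume "Const c \<in> adom \<J>"
    then obtain u where u: "Const c = h u" "u \<in> adom \<I>" unfolding dom by blast
    then have "u = Const c" using h(2) by metis
    then show "c \<in> cnst Sg" using u(2) assms(1) by (simp add: is_instance_def)
  qed
  moreover have "\<forall>t\<in>adom \<J>. (univ Sg, [t]) \<in> \<J>"
  proof
    fix t assume "t \<in> adom \<J>"
    then obtain u where u: "t = h u" "u \<in> adom \<I>" unfolding dom by blast
    then have "(univ Sg, [u]) \<in> \<I>" using assms(1) by (simp add: is_instance_def)
    then show "(univ Sg, [t]) \<in> \<J>" unfolding h(3)[symmetric] by (rule rev_image_eqI) (simp add: u)
  qed
  ultimately show ?thesis unfolding is_instance_def by simp
qed

lemma length_le_max_arity:
  assumes "wf_sig Sg" "is_instance Sg \<I>" "(R, ts) \<in> \<I>"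
  shows "ts \<noteq> [] \<and> length ts \<le> max_arity Sg \<and> set ts \<subseteq> adom \<I>"
proof -
  have "R \<in> rels Sg" "length ts = arity Sg R" using assms(2,3) by (auto simp: is_instance_def)
  moreover have "1 \<le> arity Sg R" "arity Sg R \<le> max_arity Sg"
    using assms(1) \<open>R \<in> rels Sg\<close> unfolding max_arity_def wf_sig_def by auto
  ultimately show ?thesis using assms(3) by (auto simp: adom_def)
qed

section \<open>Invariant colorings\<close>

text \<open>These are the tuples that can carry a color at \<open>s\<close>: colors have positive
  arity, and no atom is longer than the maximal arity.\<close>

definition tuples_below ::
  "('r, 'c) sig \<Rightarrow> ('r, 'c, 'n) atm set \<Rightarrow> (('c, 'n) trm \<Rightarrow> node) \<Rightarrow> node \<Rightarrow> ('c, 'n) trm list set" where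
  "tuples_below Sg \<I> f s =
     {ts. ts \<noteq> [] \<and> length ts \<le> max_arity Sg \<and> (\<forall>t\<in>set ts. t \<in> adom \<I> \<and> prefix s (f t))}"

text \<open>
  Only the number of values of \<open>\<chi> s\<close> has to be bounded uniformly: the values at different nodes are
  never compared, so they can be renamed into a fixed finite set of colors at every node separately.
\<close>

locale invariant_coloring =
  fixes Sg :: "('r, 'c) sig" and \<I> :: "('r, 'c, 'n) atm set"
    and f :: "('c, 'n) trm \<Rightarrow> node" and \<chi> :: "node \<Rightarrow> ('c, 'n) trm list \<Rightarrow> 'k" and B :: nat
  assumes inst: "is_instance Sg \<I>"
    and antichain: "\<lbrakk>t \<in> adom \<I>; t' \<in> adom \<I>; prefix (f t) (f t')\<rbrakk> \<Longrightarrow> t = t'"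
    and bounded: "finite (\<chi> s ` tuples_below Sg \<I> f s) \<and> card (\<chi> s ` tuples_below Sg \<I> f s) \<le> B"
    and child: "\<lbrakk>as \<in> tuples_below Sg \<I> f (s @ [i]); as' \<in> tuples_below Sg \<I> f (s @ [i]);
        length as = length as'; \<chi> (s @ [i]) as = \<chi> (s @ [i]) as'\<rbrakk> \<Longrightarrow> \<chi> s as = \<chi> s as'"
    and join: "\<lbrakk>as \<in> tuples_below Sg \<I> f (s @ [False]); as' \<in> tuples_below Sg \<I> f (s @ [False]);
        bs \<in> tuples_below Sg \<I> f (s @ [True]); bs' \<in> tuples_below Sg \<I> f (s @ [True]);
        length as = length as'; \<chi> (s @ [False]) as = \<chi> (s @ [False]) as';
        length bs = length bs'; \<chi> (s @ [True]) bs = \<chi> (s @ [True]) bs';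
        J \<subseteq> {1..length as + length bs}; card J = length as\<rbrakk>
        \<Longrightarrow> \<chi> s (interleave J as bs) = \<chi> s (interleave J as' bs')"
    and decided: "(R, ts) \<in> \<I> \<Longrightarrow> (\<exists>t. R = univ Sg \<and> ts = [t]) \<or>
        (\<exists>s i. ts \<in> tuples_below Sg \<I> f (s @ [i]) \<and>
           (\<forall>ts'\<in>tuples_below Sg \<I> f (s @ [i]).
              length ts' = length ts \<longrightarrow> \<chi> (s @ [i]) ts' = \<chi> (s @ [i]) ts \<longrightarrow> (R, ts') \<in> \<I>))"
begin

section \<open>Palette and decorated tree obtained from an invariant coloring\<close>

abbreviation "tup \<equiv> tuples_below Sg \<I> f"

abbreviation "N \<equiv> max_arity Sg"

definition leaves :: "node set" where "leaves = f ` adom \<I>"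

definition enc :: "node \<Rightarrow> 'k \<Rightarrow> nat" where
  "enc s = (SOME e. inj_on e (\<chi> s ` tup s) \<and> e ` \<chi> s ` tup s \<subseteq> {..<B})"

lemma enc: "inj_on (enc s) (\<chi> s ` tup s)" "as \<in> tup s \<Longrightarrow> enc s (\<chi> s as) < B"
proof -
  have "\<exists>e. inj_on e (\<chi> s ` tup s) \<and> e ` \<chi> s ` tup s \<subseteq> {..<B}"
    using card_le_inj[of "\<chi> s ` tup s" "{..<B}"] bounded[of s] by auto
  from someI_ex[OF this, folded enc_def]
  show "inj_on (enc s) (\<chi> s ` tup s)" "as \<in> tup s \<Longrightarrow> enc s (\<chi> s as) < B" by auto
qed

text \<open>Coding the length into the color makes its arity decodable. Index 0 is reserved for the
  origin colors, which tuples at a leaf receive; all other classes are shifted by one.\<close>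

definition color :: "node \<Rightarrow> ('c, 'n) trm list \<Rightarrow> nat" where
  "color s as = prod_encode (length as, if s \<in> leaves then 0 else Suc (enc s (\<chi> s as)))"

definition pal :: "nat palette" where
  "pal = \<lparr>colors = prod_encode ` ({1..N} \<times> {..B}), col_arity = fst \<circ> prod_decode,
     origin = (\<lambda>i. prod_encode (i, 0))\<rparr>"

text \<open>Nulls of the represented instance are nodes, so a null becomes the leaf at which it is
  placed.\<close>

definition trm_of :: "('c, 'n) trm \<Rightarrow> ('c, node) trm" where
  "trm_of t = (case t of Const c \<Rightarrow> Const c | Null n \<Rightarrow> Null (f t))"

text \<open>Each transition between classes becomes an instruction. A tuple split between the
  children first gets a color by \<open>Add\<close> and is materialized at the parent; a color is
  turned into \<open>R\<close> only if all its tuples satisfy \<open>R\<close>.\<close>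

definition decs :: "node \<Rightarrow> ('r, 'c, nat) decorator set" where
  "decs s = (if s \<in> leaves
     then {ConstD c | c. Const c \<in> adom \<I> \<and> f (Const c) = s} \<union>
          {StarD | n. Null n \<in> adom \<I> \<and> f (Null n) = s}
     else {Add (color (s @ [False]) as) (color (s @ [True]) bs) J (color s (interleave J as bs)) | as bs J.
             as \<in> tup (s @ [False]) \<and> bs \<in> tup (s @ [True]) \<and> length as + length bs \<le> N \<and>
             J \<subset> {1..length as + length bs} \<and> card J = length as}
        \<union> {Recol i (color (s @ [i]) as) (color s as) | i as. as \<in> tup (s @ [i])}
        \<union> {Mat i (color (s @ [i]) as) R | i as R. as \<in> tup (s @ [i]) \<and> R \<in> rels Sg \<and>
             arity Sg R = length as \<and>
             (\<forall>as'\<in>tup (s @ [i]). color (s @ [i]) as' = color (s @ [i]) as \<longrightarrow> (R, as') \<in> \<I>)})"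

section \<open>Tuples at leaves, and invariance carried over from \<open>\<chi>\<close> to
  \<open>color\<close>\<close>

lemma tup_leaf:
  assumes "as \<in> tup (f t)" "t \<in> adom \<I>"
  shows "as = replicate (length as) t"
proof (rule replicate_eqI)
  fix x assume "x \<in> set as"
  then have "x \<in> adom \<I>" "prefix (f t) (f x)" using assms(1) by (auto simp: tuples_below_def)
  then show "x = t" using antichain assms(2) by metis
qed simp

lemma tup_below_leaf:
  assumes "s \<in> leaves" "u \<noteq> []"
  shows "tup (s @ u) = {}"
proof (rule ccontr)
  assume "tup (s @ u) \<noteq> {}"
  then obtain t where t: "t \<in> adom \<I>" "prefix (s @ u) (f t)"
    unfolding tuples_below_def by (metis (mono_tags, lifting) Collect_empty_eq last_in_set)
  obtain t0 where t0: "t0 \<in> adom \<I>" "s = f t0" using assms(1) by (auto simp: leaves_def)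
  have "prefix s (f t)" using t(2) append_prefixD by blast
  then have "t0 = t" using antichain t t0 by blast
  then show False using t(2) t0(2) assms(2) by (auto simp: prefix_def)
qed

lemma tup_child: "as \<in> tup (s @ [i]) \<Longrightarrow> as \<in> tup s"
  unfolding tuples_below_def by (auto simp: prefix_def)

lemma tup_interleave:
  assumes "as \<in> tup (s @ [False])" "bs \<in> tup (s @ [True])" "length as + length bs \<le> N"
    "J \<subseteq> {1..length as + length bs}" "card J = length as"
  shows "interleave J as bs \<in> tup s"
proof -
  have "interleave J as bs \<noteq> []"
    using assms(1) length_interleave[of J as bs] by (force simp: tuples_below_def)
  then show ?thesis
    using tup_child[OF assms(1)] tup_child[OF assms(2)] set_interleave[OF assms(4,5)] assms(3)
    unfolding tuples_below_def by auto
qed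

lemma color_eq_length: "color s as = color s as' \<Longrightarrow> length as = length as'"
  by (simp add: color_def)

text \<open>Off the leaves \<open>enc s\<close> is injective on classes. At a leaf all tuples share
  an origin color per length, but there only one tuple of each length exists.\<close>

lemma color_eqD:
  assumes "color s as = color s as'" "as \<in> tup s" "as' \<in> tup s"
  shows "\<chi> s as = \<chi> s as'"
proof (cases "s \<in> leaves")
  case True
  then show ?thesis using assms tup_leaf color_eq_length[OF assms(1)] unfolding leaves_def
    by (metis imageE)
next
  case False
  then show ?thesis using assms enc(1)[of s] by (auto simp: color_def inj_on_def)
qed

lemma color_eqI:
  "\<lbrakk>length as = length as'; \<chi> s as = \<chi> s as'\<rbrakk> \<Longrightarrow> color s as = color s as'"
  by (simp add: color_def)

lemma color_child:
  assumes "as \<in> tup (s @ [i])" "as' \<in> tup (s @ [i])" "color (s @ [i]) as = color (s @ [i]) as'"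
  shows "color s as = color s as'"
proof (rule color_eqI)
  show len: "length as = length as'" using assms(3) by (rule color_eq_length)
  show "\<chi> s as = \<chi> s as'" using child[OF assms(1,2) len color_eqD[OF assms(3,1,2)]] .
qed

lemma color_join:
  assumes "as \<in> tup (s @ [False])" "as' \<in> tup (s @ [False])" "bs \<in> tup (s @ [True])" "bs' \<in> tup (s @ [True])"
    "color (s @ [False]) as = color (s @ [False]) as'" "color (s @ [True]) bs = color (s @ [True]) bs'"
    "J \<subseteq> {1..length as + length bs}" "card J = length as"
  shows "color s (interleave J as bs) = color s (interleave J as' bs')"
proof (rule color_eqI)
  show "\<chi> s (interleave J as bs) = \<chi> s (interleave J as' bs')"
    using join[OF assms(1-4) _ _ _ _ assms(7,8)] color_eqD color_eq_length assms(1-6) by blast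
qed (simp add: color_eq_length[OF assms(5)] color_eq_length[OF assms(6)])

lemma color_in_pal:
  assumes "as \<in> tup s"
  shows "color s as \<in> colors pal" "col_arity pal (color s as) = length as"
proof -
  have "length as \<in> {1..N}" using assms by (auto simp: tuples_below_def Suc_le_eq)
  moreover have "(if s \<in> leaves then 0 else Suc (enc s (\<chi> s as))) \<le> B"
    using enc(2)[OF assms] by (simp add: Suc_le_eq)
  ultimately show "color s as \<in> colors pal" unfolding color_def pal_def by (simp add: inj_image_mem_iff)
  show "col_arity pal (color s as) = length as" by (simp add: color_def pal_def)
qed

lemma wf_pal: "wf_palette Sg pal"
proof -
  have "finite (colors pal)" by (simp add: pal_def)
  moreover have "\<forall>l\<in>colors pal. 1 \<le> col_arity pal l" by (simp add: pal_def)
  moreover have "origin pal i \<in> colors pal \<and> col_arity pal (origin pal i) = i" if "i \<in> {1..N}" for i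
    using that by (simp add: pal_def inj_image_mem_iff)
  ultimately show ?thesis unfolding wf_palette_def by simp
qed

section \<open>Well-decoratedness and semantics of the constructed tree\<close>

lemma ConstD_decs: "ConstD c \<in> decs s \<longleftrightarrow> Const c \<in> adom \<I> \<and> f (Const c) = s"
  by (auto simp: decs_def leaves_def)

lemma StarD_decs: "StarD \<in> decs s \<longleftrightarrow> (\<exists>n. Null n \<in> adom \<I> \<and> f (Null n) = s)"
  by (auto simp: decs_def leaves_def)

lemma pseudoleaf_decs: "pseudoleaf decs s \<longleftrightarrow> s \<in> leaves"
  unfolding pseudoleaf_def ConstD_decs StarD_decs leaves_def
proof safe
  fix t assume "t \<in> adom \<I>" "\<nexists>c. Const c \<in> adom \<I> \<and> f (Const c) = f t"
  then show "\<exists>n. Null n \<in> adom \<I> \<and> f (Null n) = f t" by (cases t) auto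
qed auto

lemma f_inj: "\<lbrakk>t \<in> adom \<I>; t' \<in> adom \<I>; f t = f t'\<rbrakk> \<Longrightarrow> t = t'"
  by (rule antichain) simp_all

lemma decs_leaf:
  assumes "t \<in> adom \<I>"
  shows "decs (f t) = (case t of Const c \<Rightarrow> {ConstD c} | Null n \<Rightarrow> {StarD})"
proof -
  have "f t \<in> leaves" using assms by (simp add: leaves_def)
  then show ?thesis using assms
    by (cases t) (auto simp: decs_def dest: f_inj)
qed

text \<open>The essential point is compatibility: \<open>color_join\<close> and
  \<open>color_child\<close> make the target color a function of the source colors and
  \<open>J\<close>, whichever representatives produced the instruction.\<close>

lemma well_decorated_decs: "well_decorated Sg pal decs"
proof -
  have "wf_decorator Sg pal d" if d: "d \<in> decs s" for s d
  proof (cases "s \<in> leaves")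
    case True
    then show ?thesis using d inst by (auto simp: decs_def is_instance_def)
  next
    case False
    from d consider
      (a) as bs J where "d = Add (color (s @ [False]) as) (color (s @ [True]) bs) J (color s (interleave J as bs))"
        "as \<in> tup (s @ [False])" "bs \<in> tup (s @ [True])" "length as + length bs \<le> N"
        "J \<subset> {1..length as + length bs}" "card J = length as"
    | (r) i as where "d = Recol i (color (s @ [i]) as) (color s as)" "as \<in> tup (s @ [i])"
    | (m) i as R where "d = Mat i (color (s @ [i]) as) R" "as \<in> tup (s @ [i])" "R \<in> rels Sg"
        "arity Sg R = length as"
      using False by (auto simp: decs_def)
    then show ?thesis
    proof cases
      case a
      then have "interleave J as bs \<in> tup s" using tup_interleave by blast
      then show ?thesis using a by (simp add: color_in_pal)
    next
      case r
      then show ?thesis using tup_child by (simp add: color_in_pal)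
    next
      case m
      then show ?thesis by (simp add: color_in_pal)
    qed
  qed
  moreover have "decs s = {StarD}" if "StarD \<in> decs s" for s
    using that decs_leaf unfolding StarD_decs by fastforce
  moreover have "decs s = {ConstD c}" if "ConstD c \<in> decs s" for s c
    using that decs_leaf unfolding ConstD_decs by fastforce
  moreover have "decs (s @ u) = {}" if "s \<in> leaves" "u \<noteq> []" for s u
  proof -
    have "s @ u \<notin> leaves"
    proof
      assume "s @ u \<in> leaves"
      then obtain t where "t \<in> adom \<I>" "s @ u = f t" by (auto simp: leaves_def)
      moreover from that(1) obtain t0 where "t0 \<in> adom \<I>" "s = f t0" unfolding leaves_def by blast
      ultimately show False using antichain[of t0 t] that(2)
        by (metis append_self_conv prefixI)
    qed
    then show ?thesis using tup_below_leaf[OF that(1)] by (auto simp: decs_def)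
  qed
  moreover have "\<not> incompatible d d'" if d: "d \<in> decs s" "d' \<in> decs s" for s d d'
  proof
    assume "incompatible d d'"
    then consider (a) \<kappa> \<mu> J l l' where "d = Add \<kappa> \<mu> J l" "d' = Add \<kappa> \<mu> J l'" "l \<noteq> l'"
      | (r) i \<kappa> l l' where "d = Recol i \<kappa> l" "d' = Recol i \<kappa> l'" "l \<noteq> l'"
      unfolding incompatible_def by blast
    then show False
    proof cases
      case a
      obtain as bs where 1: "\<kappa> = color (s @ [False]) as" "\<mu> = color (s @ [True]) bs"
          "l = color s (interleave J as bs)" "as \<in> tup (s @ [False])" "bs \<in> tup (s @ [True])"
          "J \<subset> {1..length as + length bs}" "card J = length as"
        using d(1) a(1) by (auto simp: decs_def split: if_splits)
      obtain as' bs' where 2: "\<kappa> = color (s @ [False]) as'" "\<mu> = color (s @ [True]) bs'"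
          "l' = color s (interleave J as' bs')" "as' \<in> tup (s @ [False])" "bs' \<in> tup (s @ [True])"
        using d(2) a(2) by (auto simp: decs_def split: if_splits)
      show False using color_join[of as s as' bs bs' J] 1 2 a(3) by auto
    next
      case r
      obtain as where 1: "\<kappa> = color (s @ [i]) as" "l = color s as" "as \<in> tup (s @ [i])"
        using d(1) r(1) by (auto simp: decs_def split: if_splits)
      obtain as' where 2: "\<kappa> = color (s @ [i]) as'" "l' = color s as'" "as' \<in> tup (s @ [i])"
        using d(2) r(2) by (auto simp: decs_def split: if_splits)
      show False using color_child[of as s i as'] 1 2 r(3) by simp
    qed
  qed
  moreover have "s = s'" if "ConstD c \<in> decs s \<and> ConstD c \<in> decs s'" for s s' c
    using that unfolding ConstD_decs by metis
  ultimately show ?thesis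
    unfolding well_decorated_def pseudoleaf_decs by (intro conjI allI ballI impI) simp_all
qed

text \<open>Induction on the least fixed point; each rule application is matched by a tuple of the
  original instance.\<close>

lemma pw_colp_sound:
  assumes "(s, l, xs) \<in> pw_colp Sg pal decs"
  shows "\<exists>as\<in>tup s. l = color s as \<and> xs = map trm_of as"
  using assms
proof induction
  case (1 c s i)
  then have "Const c \<in> adom \<I>" "f (Const c) = s" by (simp_all add: ConstD_decs)
  then show ?case using 1(2)
    by (intro bexI[of _ "replicate i (Const c)"])
       (auto simp: color_def pal_def leaves_def trm_of_def tuples_below_def)
next
  case (2 s i)
  then obtain n where "Null n \<in> adom \<I>" "f (Null n) = s" by (auto simp: StarD_decs)
  then show ?case using 2(2)
    by (intro bexI[of _ "replicate i (Null n)"])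
       (auto simp: color_def pal_def leaves_def trm_of_def tuples_below_def)
next
  case (3 s \<kappa> \<mu> J l xs ys)
  obtain as where as: "as \<in> tup (s @ [False])" "\<kappa> = color (s @ [False]) as" "xs = map trm_of as"
    using 3 by blast
  obtain bs where bs: "bs \<in> tup (s @ [True])" "\<mu> = color (s @ [True]) bs" "ys = map trm_of bs"
    using 3 by blast
  \<comment> \<open>The instruction stems from representatives \<open>as'\<close> and
    \<open>bs'\<close>, possibly different from \<open>as\<close> and \<open>bs\<close>; equal
    colors make them interchangeable.\<close>
  obtain as' bs' where 1: "\<kappa> = color (s @ [False]) as'" "\<mu> = color (s @ [True]) bs'"
      "l = color s (interleave J as' bs')" "as' \<in> tup (s @ [False])" "bs' \<in> tup (s @ [True])"
      "J \<subset> {1..length as' + length bs'}" "card J = length as'" "length as' + length bs' \<le> N"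
    using 3(2) by (auto simp: decs_def split: if_splits)
  have len: "length as' = length as" "length bs' = length bs"
    using as bs 1 color_eq_length by metis+
  have "interleave J as bs \<in> tup s"
    using tup_interleave[of as s bs J] 1 as bs len by auto
  moreover have "l = color s (interleave J as bs)"
    using color_join[of as' s as bs' bs J] 1 as bs by auto
  moreover have "interleave J xs ys = map trm_of (interleave J as bs)"
    using map_interleave[of J as bs trm_of] 1(6,7) as(3) bs(3) len by simp
  ultimately show ?case by blast
next
  case (4 s i \<kappa> l xs)
  obtain as where as: "as \<in> tup (s @ [i])" "\<kappa> = color (s @ [i]) as" "xs = map trm_of as"
    using 4 by blast
  obtain as' where "\<kappa> = color (s @ [i]) as'" "l = color s as'" "as' \<in> tup (s @ [i])"
    using 4(2) by (auto simp: decs_def split: if_splits)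
  then show ?case using as color_child tup_child by metis
next
  case (5 s i l xs)
  then obtain as where as: "as \<in> tup (s @ [i])" "l = color (s @ [i]) as" by blast
  have "s \<notin> leaves" using 5(1) by (simp add: pseudoleaf_decs)
  \<comment> \<open>Every color occurring at a child is the source of some \<open>Recol\<close>, so
    the default rule never fires.\<close>
  then have "Recol i l (color s as) \<in> decs s" using as by (auto simp: decs_def)
  then show ?case using 5(2) by blast
qed

text \<open>The tree is infinite, but the leaves of one tuple have bounded depth. The induction is
  on that depth relative to \<open>s\<close>; a tuple meeting both children is split and reassembled
  by \<open>Add\<close>.\<close>

lemma pw_colp_complete:
  assumes "as \<in> tup s"
  shows "(s, color s as, map trm_of as) \<in> pw_colp Sg pal decs"
proof -
  have "(s, color s as, map trm_of as) \<in> pw_colp Sg pal decs"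
    if "as \<in> tup s" "\<forall>a\<in>set as. length (f a) < length s + n" for n s as
    using that
  proof (induction n arbitrary: s as)
    case 0
    then have False unfolding tuples_below_def
      by (metis (mono_tags, lifting) add_0_right last_in_set leD mem_Collect_eq prefix_length_le)
    then show ?case ..
  next
    case (Suc n)
    show ?case
    proof (cases "s \<in> leaves")
      case True
      then obtain t where t: "t \<in> adom \<I>" "s = f t" by (auto simp: leaves_def)
      have as: "as = replicate (length as) t" using Suc.prems t tup_leaf by blast
      have len: "length as \<in> {1..N}" using Suc.prems(1) by (auto simp: tuples_below_def Suc_le_eq)
      have c: "color (f t) as = origin pal (length as)" using True t by (simp add: color_def pal_def)
      show ?thesis
      proof (cases t)
        case (Const c)
        then have "ConstD c \<in> decs s" using t by (simp add: ConstD_decs)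
        from pw_colp.intros(1)[of c decs s, OF this len] show ?thesis
          by (subst (2) as) (use t Const c in \<open>simp add: trm_of_def\<close>)
      next
        case (Null m)
        then have "StarD \<in> decs s" using t by (auto simp: StarD_decs)
        from pw_colp.intros(2)[of decs s, OF this len] show ?thesis
          by (subst (2) as) (use t Null c in \<open>simp add: trm_of_def\<close>)
      qed
    next
      case False
      then have nps: "\<not> pseudoleaf decs s" by (simp add: pseudoleaf_decs)
      have dir: "prefix (s @ [False]) (f a) \<or> prefix (s @ [True]) (f a)" if "a \<in> set as" for a
      proof -
        have a: "a \<in> adom \<I>" "prefix s (f a)" using Suc.prems(1) that by (auto simp: tuples_below_def)
        then obtain u where u: "f a = s @ u" by (auto simp: prefix_def)
        have "u \<noteq> []" using False a(1) u by (auto simp: leaves_def)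
        then obtain b v where "u = b # v" by (cases u) auto
        then show ?thesis using u by (cases b) auto
      qed
      have IH: "(s @ [i], color (s @ [i]) bs, map trm_of bs) \<in> pw_colp Sg pal decs"
        if "bs \<in> tup (s @ [i])" "set bs \<subseteq> set as" for i bs
        using Suc.IH[of bs "s @ [i]"] that Suc.prems(2) by auto
      define Q where "Q a \<longleftrightarrow> prefix (s @ [False]) (f a)" for a
      have one: ?thesis if "as \<in> tup (s @ [i])" for i
      proof -
        have "Recol i (color (s @ [i]) as) (color s as) \<in> decs s"
          using that False by (auto simp: decs_def)
        from pw_colp.intros(4)[OF nps this IH[OF that]] show ?thesis by simp
      qed
      consider "\<forall>a\<in>set as. Q a" | "\<forall>a\<in>set as. \<not> Q a" | "\<exists>a\<in>set as. Q a" "\<exists>a\<in>set as. \<not> Q a" by blast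
      then show ?thesis
      proof cases
        case 1
        then have "as \<in> tup (s @ [False])" using Suc.prems(1) by (auto simp: tuples_below_def Q_def)
        then show ?thesis by (rule one)
      next
        case 2
        then have "as \<in> tup (s @ [True])" using Suc.prems(1) dir by (auto simp: tuples_below_def Q_def)
        then show ?thesis by (rule one)
      next
        case 3
        define xs ys where "xs = filter Q as" and "ys = filter (\<lambda>a. \<not> Q a) as"
        define J where "J = {j \<in> {1..length as}. Q (as ! (j - 1))}"
        have len: "length xs + length ys = length as"
          unfolding xs_def ys_def by (rule sum_length_filter_compl)
        have J: "interleave J xs ys = as" "card J = length xs" "J \<subseteq> {1..length as}"
          using interleave_filter[of as Q] by (simp_all add: J_def xs_def ys_def)
        have ne: "xs \<noteq> []" "ys \<noteq> []" using 3 by (auto simp: xs_def ys_def filter_empty_conv)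
        have xs: "xs \<in> tup (s @ [False])" and ys: "ys \<in> tup (s @ [True])"
          using Suc.prems(1) dir ne len by (auto simp: tuples_below_def xs_def ys_def Q_def)
        have "length as \<le> N" using Suc.prems(1) by (simp add: tuples_below_def)
        \<comment> \<open>\<open>Add\<close> demands a proper subset of the positions; some position
          is left over because \<open>ys\<close> is non-empty.\<close>
        moreover have "J \<subset> {1..length as}" using J(2,3) len ne by force
        ultimately have "Add (color (s @ [False]) xs) (color (s @ [True]) ys) J (color s as) \<in> decs s"
          using False xs ys J len unfolding decs_def if_not_P[OF False]
          by (intro UnI1 CollectI exI[of _ xs] exI[of _ ys] exI[of _ J]) simp
        from pw_colp.intros(3)[OF nps this IH[OF xs] IH[OF ys]]
        have "(s, color s as, interleave J (map trm_of xs) (map trm_of ys)) \<in> pw_colp Sg pal decs"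
          by (auto simp: xs_def ys_def)
        then show ?thesis using map_interleave[of J xs ys trm_of] J len by simp
      qed
    qed
  qed
  from this[OF assms, of "Suc (Max (insert 0 (length ` f ` set as)))"] show ?thesis
    by (simp add: less_Suc_eq_le trans_le_add2)
qed

lemma pw_col_iff: "pw_col Sg pal decs s l = {map trm_of as | as. as \<in> tup s \<and> l = color s as}"
proof (intro set_eqI iffI)
  fix xs assume "xs \<in> pw_col Sg pal decs s l"
  then show "xs \<in> {map trm_of as | as. as \<in> tup s \<and> l = color s as}"
    using pw_colp_sound unfolding pw_col_def by blast
next
  fix xs assume "xs \<in> {map trm_of as | as. as \<in> tup s \<and> l = color s as}"
  then show "xs \<in> pw_col Sg pal decs s l"
    using pw_colp_complete unfolding pw_col_def by blast
qed

text \<open>By \<open>decided\<close>, an atom is either some \<open>\<top>(t)\<close>, produced by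
  the pseudoleaf of \<open>t\<close>, or the class of its tuple at some child licenses a
  \<open>Mat\<close>. Conversely, \<open>Mat\<close> occurs only for colors all of whose tuples
  satisfy the relation.\<close>

lemma pw_instance_decs: "(\<lambda>(R, ts). (R, map trm_of ts)) ` \<I> = pw_instance Sg pal decs"
proof
  show "(\<lambda>(R, ts). (R, map trm_of ts)) ` \<I> \<subseteq> pw_instance Sg pal decs"
  proof clarify
    fix R ts assume at: "(R, ts) \<in> \<I>"
    from decided[OF at] show "(R, map trm_of ts) \<in> pw_instance Sg pal decs"
    proof (elim disjE exE conjE)
      fix t assume t: "R = univ Sg" "ts = [t]"
      have a: "t \<in> adom \<I>" using at t by (force simp: adom_def)
      then have "pseudoleaf decs (f t)" by (simp add: pseudoleaf_decs leaves_def)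
      then have "(R, map trm_of ts) \<in> pw_atoms Sg pal decs (f t)"
        using t a by (cases t) (auto simp: pw_atoms_def trm_of_def ConstD_decs StarD_decs)
      then show ?thesis by (auto simp: pw_instance_def)
    next
      fix s i
      assume ts: "ts \<in> tup (s @ [i])"
        and d: "\<forall>ts'\<in>tup (s @ [i]). length ts' = length ts \<longrightarrow> \<chi> (s @ [i]) ts' = \<chi> (s @ [i]) ts \<longrightarrow> (R, ts') \<in> \<I>"
      have "s \<notin> leaves" using tup_below_leaf[of s "[i]"] ts by auto
      moreover have "R \<in> rels Sg" "arity Sg R = length ts" using inst at by (auto simp: is_instance_def)
      moreover have "\<forall>as'\<in>tup (s @ [i]). color (s @ [i]) as' = color (s @ [i]) ts \<longrightarrow> (R, as') \<in> \<I>"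
        using d ts color_eqD color_eq_length by blast
      ultimately have "Mat i (color (s @ [i]) ts) R \<in> decs s" using ts by (auto simp: decs_def)
      then have "(R, map trm_of ts) \<in> pw_atoms Sg pal decs s"
        unfolding pw_atoms_def pseudoleaf_decs if_not_P[OF \<open>s \<notin> leaves\<close>] pw_col_iff
        using ts by (intro UnI2 CollectI exI[of _ R] exI[of _ "map trm_of ts"]) blast
      then show ?thesis by (auto simp: pw_instance_def)
    qed
  qed
  show "pw_instance Sg pal decs \<subseteq> (\<lambda>(R, ts). (R, map trm_of ts)) ` \<I>"
  proof
    fix A assume "A \<in> pw_instance Sg pal decs"
    then obtain s where A: "A \<in> pw_atoms Sg pal decs s" by (auto simp: pw_instance_def)
    have top: "(univ Sg, [t]) \<in> \<I>" if "t \<in> adom \<I>" for t using inst that by (simp add: is_instance_def)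
    show "A \<in> (\<lambda>(R, ts). (R, map trm_of ts)) ` \<I>"
    proof (cases "s \<in> leaves")
      case True
      then obtain t where t: "t \<in> adom \<I>" "s = f t" by (auto simp: leaves_def)
      then have "A = (univ Sg, [trm_of t])" using A True
        by (cases t) (auto simp: pw_atoms_def pseudoleaf_decs decs_leaf trm_of_def split: if_splits)
      then show ?thesis using top[OF t(1)] by force
    next
      case False
      have "RAdd \<kappa> \<mu> J R \<notin> decs s" for \<kappa> \<mu> J R by (auto simp: decs_def)
      then obtain R i as where "A = (R, map trm_of as)" "as \<in> tup (s @ [i])"
          "Mat i (color (s @ [i]) as) R \<in> decs s"
        using A False unfolding pw_atoms_def pseudoleaf_decs pw_col_iff by auto
      moreover from this have "(R, as) \<in> \<I>" using False by (auto simp: decs_def)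
      ultimately show ?thesis by force
    qed
  qed
qed

theorem finite_partitionwidth: "finite_partitionwidth Sg \<I>"
proof -
  have "inj_on trm_of (adom \<I>)"
    by (rule inj_onI) (auto simp: trm_of_def split: trm.splits dest: f_inj)
  then have "bij_betw trm_of (adom \<I>) (adom (pw_instance Sg pal decs))"
    unfolding pw_instance_decs[symmetric] adom_image by (rule inj_on_imp_bij_betw)
  moreover have "\<forall>t\<in>adom \<I>. \<forall>c. trm_of t = Const c \<longleftrightarrow> t = Const c"
    by (auto simp: trm_of_def split: trm.splits)
  ultimately have "isomorphic \<I> (pw_instance Sg pal decs)"
    unfolding isomorphic_def using pw_instance_decs by blast
  then show ?thesis
    unfolding finite_partitionwidth_def using wf_pal well_decorated_decs by blast
qed

end

section \<open>Cliquewidth\<close>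

definition creates :: "(node \<Rightarrow> ('r, 'c, 'k) cw_op) \<Rightarrow> node \<Rightarrow> ('c, node) trm \<Rightarrow> bool" where
  "creates T s t \<longleftrightarrow>
     (\<exists>c \<kappa>. T s = CreateConst c \<kappa> \<and> t = Const c) \<or> (\<exists>\<kappa>. T s = CreateNull \<kappa> \<and> t = Null s)"

definition cw_pos :: "(node \<Rightarrow> ('r, 'c, 'k) cw_op) \<Rightarrow> ('c, node) trm \<Rightarrow> node" where
  "cw_pos T t = (THE s. creates T s t)"

text \<open>A null is its own creation node and a constant is created at most once, so the
  description in \<open>cw_pos\<close> is unique.\<close>

lemma cw_pos_eq:
  assumes "cw_tree Sg K T" "creates T s t"
  shows "cw_pos T t = s"
  unfolding cw_pos_def
proof (rule the_equality)
  fix s' assume "creates T s' t"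
  with assms show "s' = s" unfolding cw_tree_def creates_def by fastforce
qed fact

lemma void_below_creates:
  assumes "cw_tree Sg K T" "creates T s t" "u \<noteq> []" shows "T (s @ u) = Void"
proof -
  have "case T s of CreateConst c \<kappa> \<Rightarrow> \<forall>u. u \<noteq> [] \<longrightarrow> T (s @ u) = Void
      | CreateNull \<kappa> \<Rightarrow> \<forall>u. u \<noteq> [] \<longrightarrow> T (s @ u) = Void | _ \<Rightarrow> True"
    using assms(1) unfolding cw_tree_def
    by (elim conjE allE[of _ s]) (simp split: cw_op.splits)
  then show ?thesis using assms(2,3) by (auto simp: creates_def)
qed

lemma cw_col_creates: "cw_col T s t \<kappa> \<Longrightarrow> \<exists>u. creates T (s @ u) t"
proof (induction rule: cw_col.induct)
  case (1 s c \<kappa>)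
  then show ?case by (intro exI[of _ "[]"]) (simp add: creates_def)
next
  case (2 s \<kappa>)
  then show ?case by (intro exI[of _ "[]"]) (simp add: creates_def)
qed auto

lemma cw_col_color:
  assumes "cw_tree Sg K T" shows "cw_col T s t \<kappa> \<Longrightarrow> \<kappa> \<in> K"
proof (induction rule: cw_col.induct)
  case (1 s c \<kappa>)
  then show ?case using assms unfolding cw_tree_def by (auto dest!: spec[of _ s])
next
  case (2 s \<kappa>)
  then show ?case using assms unfolding cw_tree_def by (auto dest!: spec[of _ s])
next
  case (4 s \<kappa> \<mu> t \<nu>)
  then show ?case using assms unfolding cw_tree_def by (auto dest!: spec[of _ s])
qed auto

lemma adom_cw_instance: "adom (cw_instance Sg T) = {t. \<exists>s. creates T s t}"
proof
  have "\<exists>s. creates T s t"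
    if ts: "list_all2 (cw_col T s) ts \<kappa>s" "t \<in> set ts" for s t ts \<kappa>s
  proof -
    obtain \<kappa> where "cw_col T s t \<kappa>"
      using ts by (auto simp: list_all2_conv_all_nth in_set_conv_nth)
    from cw_col_creates[OF this] show ?thesis by blast
  qed
  moreover have "creates T s (Const c)" if "T s = CreateConst c \<kappa>" for s c \<kappa>
    using that by (simp add: creates_def)
  moreover have "creates T s (Null s)" if "T s = CreateNull \<kappa>" for s \<kappa>
    using that by (simp add: creates_def)
  ultimately show "adom (cw_instance Sg T) \<subseteq> {t. \<exists>s. creates T s t}"
    unfolding adom_def cw_instance_def by auto blast+
  show "{t. \<exists>s. creates T s t} \<subseteq> adom (cw_instance Sg T)"
  proof clarify
    fix s t assume "creates T s t"
    then have "(univ Sg, [t]) \<in> cw_instance Sg T" unfolding creates_def cw_instance_def by blast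
    then show "t \<in> adom (cw_instance Sg T)" unfolding adom_def by force
  qed
qed

text \<open>A color of \<open>t\<close> at \<open>s\<close> can only be inherited from the child
  above the creation node of \<open>t\<close>, and the operation at \<open>s\<close> treats terms of
  equal color alike.\<close>

lemma cw_col_child_cong:
  assumes cw: "cw_tree Sg K T"
    and t: "creates T (cw_pos T t) t" "prefix (s @ [i]) (cw_pos T t)"
    and eq: "\<And>\<kappa>. cw_col T (s @ [i]) t \<kappa> \<Longrightarrow> cw_col T (s @ [i]) t' \<kappa>"
    and col: "cw_col T s t \<kappa>"
  shows "cw_col T s t' \<kappa>"
proof -
  obtain u where u: "cw_pos T t = s @ i # u" using t(2) by (auto simp: prefix_def)
  have nv: "T (s @ i # u) \<noteq> Void" using t(1) u by (auto simp: creates_def)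
  have below: "j = i" if c: "cw_col T (s @ [j]) t \<nu>" for j \<nu>
  proof -
    obtain v where "creates T ((s @ [j]) @ v) t" using cw_col_creates[OF c] by blast
    from cw_pos_eq[OF cw this] u show ?thesis by simp
  qed
  \<comment> \<open>Below a creation node everything is \<open>Void\<close>, whereas the creation
    node of \<open>t\<close> lies properly below \<open>s\<close>.\<close>
  have nc: "\<not> creates T s t0" for t0
    using void_below_creates[OF cw, of s t0 "i # u"] nv by auto
  from col show ?thesis
  proof cases
    case 1
    then show ?thesis using nc by (auto simp: creates_def)
  next
    case 2
    then show ?thesis using nc by (auto simp: creates_def)
  next
    case (3 j)
    have "j = i" using below[OF 3(2)] .
    then show ?thesis using cw_col.intros(3)[of T s i t' \<kappa>, OF 3(1)] eq 3(2) by simp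
  next
    case (4 \<kappa>' \<mu> \<nu>)
    have "i = False" using below[OF 4(3)] by simp
    then show ?thesis using cw_col.intros(4)[of T s \<kappa>' \<mu> t' \<nu>, OF 4(2)] eq 4(1,3) by simp
  next
    case (5 R \<kappa>s)
    have "i = False" using below[OF 5(2)] by simp
    then show ?thesis using cw_col.intros(5)[of T s R \<kappa>s t' \<kappa>, OF 5(1)] eq 5(2) by simp
  qed
qed

text \<open>A tuple is classified by the list of the color sets of its components. All classes lie
  in the finite set \<open>V\<close> of short lists over \<open>Pow K\<close>, which bounds their
  number uniformly.\<close>

lemma finite_partitionwidth_cw_instance:
  fixes Sg :: "('r, 'c) sig" and K :: "'k set"
  assumes wf: "wf_sig Sg" and inst: "is_instance Sg (cw_instance Sg T)"
    and K: "finite K" and cw: "cw_tree Sg K T"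
  shows "finite_partitionwidth Sg (cw_instance Sg T)"
proof -
  let ?I = "cw_instance Sg T" and ?f = "cw_pos T"
  let ?tup = "tuples_below Sg ?I ?f"
  define cl where "cl s t = {\<kappa>. cw_col T s t \<kappa>}" for s t
  define \<chi> where "\<chi> s = map (cl s)" for s
  have pos: "creates T (?f t) t" if "t \<in> adom ?I" for t
    using that cw_pos_eq[OF cw] unfolding adom_cw_instance by auto
  have cl_child: "cl s t = cl s t'"
    if "t \<in> adom ?I" "t' \<in> adom ?I" "prefix (s @ [i]) (?f t)" "prefix (s @ [i]) (?f t')"
      "cl (s @ [i]) t = cl (s @ [i]) t'" for s i t t'
  proof (rule set_eqI)
    fix \<kappa>
    have "cw_col T (s @ [i]) t \<nu> \<longleftrightarrow> cw_col T (s @ [i]) t' \<nu>" for \<nu>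
      using that(5) unfolding cl_def by blast
    then show "\<kappa> \<in> cl s t \<longleftrightarrow> \<kappa> \<in> cl s t'"
      using cw_col_child_cong[OF cw pos[OF that(1)] that(3), of t' \<kappa>]
        cw_col_child_cong[OF cw pos[OF that(2)] that(4), of t \<kappa>] by (auto simp: cl_def)
  qed
  have child: "\<chi> s as = \<chi> s as'"
    if "as \<in> ?tup (s @ [i])" "as' \<in> ?tup (s @ [i])" "\<chi> (s @ [i]) as = \<chi> (s @ [i]) as'" for s i as as'
  proof -
    have len: "length as = length as'" using that(3) unfolding \<chi>_def by (metis length_map)
    show ?thesis unfolding \<chi>_def
    proof (rule nth_equalityI)
      fix j assume "j < length (map (cl s) as)"
      then have j: "j < length as" "j < length as'" using len by auto
      then have "cl (s @ [i]) (as ! j) = cl (s @ [i]) (as' ! j)"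
        using that(3) unfolding \<chi>_def by (metis nth_map)
      then have "cl s (as ! j) = cl s (as' ! j)"
        using that(1,2) nth_mem[OF j(1)] nth_mem[OF j(2)] unfolding tuples_below_def
        by (intro cl_child[of _ _ s i]) auto
      then show "map (cl s) as ! j = map (cl s) as' ! j" using j by simp
    qed (simp add: len)
  qed
  define V where "V = {xs. set xs \<subseteq> Pow K \<and> length xs \<le> max_arity Sg}"
  have finV: "finite V" unfolding V_def using K by (intro finite_lists_length_le) simp
  have sub: "\<chi> s ` ?tup s \<subseteq> V" for s
    using cw_col_color[OF cw] by (auto simp: \<chi>_def V_def tuples_below_def cl_def)
  interpret invariant_coloring Sg ?I ?f \<chi> "card V"
  proof
    show "is_instance Sg ?I" by fact
    fix t t' assume t: "t \<in> adom ?I" "t' \<in> adom ?I" "prefix (?f t) (?f t')"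
    then obtain u where u: "?f t' = ?f t @ u" by (auto simp: prefix_def)
    have "T (?f t @ u) \<noteq> Void" using pos[OF t(2)] u by (auto simp: creates_def)
    then have "u = []" using void_below_creates[OF cw pos[OF t(1)]] by blast
    then show "t = t'" using pos[OF t(1)] pos[OF t(2)] u by (auto simp: creates_def)
  next
    fix s
    show "finite (\<chi> s ` ?tup s) \<and> card (\<chi> s ` ?tup s) \<le> card V"
      using finite_subset[OF sub finV] card_mono[OF finV sub] by blast
  next
    fix s J as as' bs bs'
    assume h: "as \<in> ?tup (s @ [False])" "as' \<in> ?tup (s @ [False])" "bs \<in> ?tup (s @ [True])"
      "bs' \<in> ?tup (s @ [True])" "length as = length as'" "\<chi> (s @ [False]) as = \<chi> (s @ [False]) as'"
      "length bs = length bs'" "\<chi> (s @ [True]) bs = \<chi> (s @ [True]) bs'"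
      "J \<subseteq> {1..length as + length bs}" "card J = length as"
    have "\<chi> s as = \<chi> s as'" "\<chi> s bs = \<chi> s bs'" using h child by blast+
    then show "\<chi> s (interleave J as bs) = \<chi> s (interleave J as' bs')"
      using map_interleave[OF h(9,10), of "cl s"] map_interleave[of J as' bs' "cl s"] h
      by (simp add: \<chi>_def)
  next
    fix R ts assume at: "(R, ts) \<in> ?I"
    show "(\<exists>t. R = univ Sg \<and> ts = [t]) \<or> (\<exists>s i. ts \<in> ?tup (s @ [i]) \<and>
        (\<forall>ts'\<in>?tup (s @ [i]). length ts' = length ts \<longrightarrow> \<chi> (s @ [i]) ts' = \<chi> (s @ [i]) ts \<longrightarrow> (R, ts') \<in> ?I))"
    proof (cases "\<exists>t. R = univ Sg \<and> ts = [t]")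
      case False
      \<comment> \<open>An atom not of the exempted form comes from an \<open>AddAtoms\<close> node;
        the class at its child fixes the colors of all components and hence decides the
        atom.\<close>
      then obtain s \<kappa>s where s: "T s = AddAtoms R \<kappa>s" "list_all2 (cw_col T (s @ [False])) ts \<kappa>s"
        using at unfolding cw_instance_def by auto
      have "prefix (s @ [False]) (?f t)" if t: "t \<in> set ts" for t
      proof -
        obtain \<kappa> where "cw_col T (s @ [False]) t \<kappa>"
          using s(2) t by (auto simp: list_all2_conv_all_nth in_set_conv_nth)
        then obtain u where "creates T ((s @ [False]) @ u) t" using cw_col_creates[of T] by blast
        then have "?f t = (s @ [False]) @ u" by (rule cw_pos_eq[OF cw])
        then show ?thesis by (rule prefixI)
      qed
      then have "ts \<in> ?tup (s @ [False])"
        using length_le_max_arity[OF wf inst at] by (auto simp: tuples_below_def)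
      moreover have "(R, ts') \<in> ?I" if "length ts' = length ts" "\<chi> (s @ [False]) ts' = \<chi> (s @ [False]) ts" for ts'
      proof -
        have cl_eq: "cl (s @ [False]) (ts' ! j) = cl (s @ [False]) (ts ! j)" if "j < length ts" for j
          using that \<open>length ts' = length ts\<close> \<open>\<chi> (s @ [False]) ts' = _\<close> unfolding \<chi>_def by (metis nth_map)
        have "list_all2 (cw_col T (s @ [False])) ts' \<kappa>s"
        proof (intro list_all2_all_nthI)
          show "length ts' = length \<kappa>s" using that(1) list_all2_lengthD[OF s(2)] by simp
          fix j assume "j < length ts'"
          then have j: "j < length ts" by (simp add: that(1))
          have "\<kappa>s ! j \<in> cl (s @ [False]) (ts ! j)" using list_all2_nthD[OF s(2) j] by (simp add: cl_def)
          then show "cw_col T (s @ [False]) (ts' ! j) (\<kappa>s ! j)"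
            unfolding cl_eq[OF j, symmetric] by (simp add: cl_def)
        qed
        then show ?thesis using s(1) unfolding cw_instance_def by blast
      qed
      ultimately show ?thesis by blast
    qed simp
  next
    fix s i as as'
    assume "as \<in> ?tup (s @ [i])" "as' \<in> ?tup (s @ [i])" "\<chi> (s @ [i]) as = \<chi> (s @ [i]) as'"
    then show "\<chi> s as = \<chi> s as'" by (rule child)
  qed
  show ?thesis by (rule finite_partitionwidth)
qed

lemma finite_partitionwidth_if_finite_cliquewidth:
  assumes "wf_sig Sg" "is_instance Sg \<I>" "finite_cliquewidth Sg \<I>"
  shows "finite_partitionwidth Sg \<I>"
proof -
  obtain K :: "nat set" and T where *: "finite K" "cw_tree Sg K T" "isomorphic \<I> (cw_instance Sg T)"
    using assms(3) unfolding finite_cliquewidth_def by blast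
  then have "finite_partitionwidth Sg (cw_instance Sg T)"
    using finite_partitionwidth_cw_instance assms is_instance_isomorphic by blast
  then show ?thesis
    unfolding finite_partitionwidth_def using isomorphic_trans[OF *(3)] by blast
qed

section \<open>Separators\<close>

text \<open>On \<open>A\<close>, the map \<open>\<chi>\<close> factors through
  \<open>\<psi>\<close>.\<close>

lemma card_image_le_if_determined:
  assumes "\<And>x y. \<lbrakk>x \<in> A; y \<in> A; \<psi> x = \<psi> y\<rbrakk> \<Longrightarrow> \<chi> x = \<chi> y" "finite (\<psi> ` A)"
  shows "finite (\<chi> ` A) \<and> card (\<chi> ` A) \<le> card (\<psi> ` A)"
proof -
  have "\<chi> x = \<chi> (inv_into A \<psi> (\<psi> x))" if "x \<in> A" for x
    using assms(1)[OF that, of "inv_into A \<psi> (\<psi> x)"] that by (simp add: f_inv_into_f inv_into_into)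
  then have "\<chi> ` A = (\<lambda>v. \<chi> (inv_into A \<psi> v)) ` \<psi> ` A" unfolding image_image by (intro image_cong refl)
  then show ?thesis using assms(2) by (simp add: card_image_le)
qed

text \<open>
  A pattern over \<open>as\<close> is a list of positions in \<open>as\<close> and of parameters. The context type of \<open>as\<close> at
  \<open>s\<close> collects the atoms that result from patterns whose parameters lie outside the subtree at \<open>s\<close>,
  in the manner of the Nerode congruence.
\<close>

definition fill :: "'a list \<Rightarrow> (nat + 'a) list \<Rightarrow> 'a list" where
  "fill as p = map (case_sum ((!) as) id) p"

definition context_type ::
  "('r, 'c, 'n) atm set \<Rightarrow> (('c, 'n) trm \<Rightarrow> node) \<Rightarrow> node \<Rightarrow> ('c, 'n) trm list \<Rightarrow>
   ('r \<times> (nat + ('c, 'n) trm) list) set" where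
  "context_type \<I> f s as =
     {(R, p). (R, fill as p) \<in> \<I> \<and>
        (\<forall>j. Inl j \<in> set p \<longrightarrow> j < length as) \<and> (\<forall>z. Inr z \<in> set p \<longrightarrow> \<not> prefix s (f z))}"

section \<open>Behavior of context types along the binary tree\<close>

lemma context_typeD:
  assumes "(R, p) \<in> context_type \<I> f s as"
  shows "(R, fill as p) \<in> \<I>" "Inl j \<in> set p \<Longrightarrow> j < length as" "Inr z \<in> set p \<Longrightarrow> \<not> prefix s (f z)"
  using assms by (auto simp: context_type_def)

lemma context_typeI:
  assumes "(R, fill as p) \<in> \<I>" "\<And>j. Inl j \<in> set p \<Longrightarrow> j < length as"
    "\<And>z. Inr z \<in> set p \<Longrightarrow> \<not> prefix s (f z)"
  shows "(R, p) \<in> context_type \<I> f s as"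
  using assms by (auto simp: context_type_def)

text \<open>Parameters outside the subtree at \<open>s\<close> are also outside the subtree at its
  child, so the type at \<open>s\<close> is a restriction of the type at the child.\<close>

lemma context_type_child_mono:
  assumes len: "length as = length as'"
    and eq: "context_type \<I> f (s @ [i]) as \<subseteq> context_type \<I> f (s @ [i]) as'"
  shows "context_type \<I> f s as \<subseteq> context_type \<I> f s as'"
proof clarify
  fix R p assume p: "(R, p) \<in> context_type \<I> f s as"
  have "(R, p) \<in> context_type \<I> f (s @ [i]) as"
  proof (rule context_typeI)
    fix z assume "Inr z \<in> set p"
    then show "\<not> prefix (s @ [i]) (f z)" using context_typeD(3)[OF p] append_prefixD by metis
  qed (use context_typeD[OF p] in auto)
  then have "(R, p) \<in> context_type \<I> f (s @ [i]) as'" using eq by blast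
  then show "(R, p) \<in> context_type \<I> f s as'"
    using context_typeD(1) context_typeD(2,3)[OF p] len by (metis context_typeI)
qed

text \<open>Translates patterns over an interleaving into patterns over its first part: entries from
  \<open>bs\<close> become parameters. \<open>Suc j\<close> appears because \<open>J\<close> counts
  from 1. \<open>param_left\<close> is the mirror image.\<close>

definition param_right :: "nat set \<Rightarrow> 'a list \<Rightarrow> nat + 'a \<Rightarrow> nat + 'a" where
  "param_right J bs = case_sum (\<lambda>j. if Suc j \<in> J then Inl (card (J \<inter> {1..<Suc j}))
     else Inr (bs ! card ({1..<Suc j} - J))) Inr"

definition param_left :: "nat set \<Rightarrow> 'a list \<Rightarrow> nat + 'a \<Rightarrow> nat + 'a" where
  "param_left J as = case_sum (\<lambda>j. if Suc j \<in> J then Inr (as ! card (J \<inter> {1..<Suc j}))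
     else Inl (card ({1..<Suc j} - J))) Inr"

lemma fill_interleave:
  assumes "\<And>j. Inl j \<in> set p \<Longrightarrow> j < length as + length bs"
  shows "fill (interleave J as bs) p = fill as (map (param_right J bs) p)"
    and "fill (interleave J as bs) p = fill bs (map (param_left J as) p)"
proof -
  have "case_sum ((!) (interleave J as bs)) id q = case_sum ((!) as) id (param_right J bs q)"
      and "case_sum ((!) (interleave J as bs)) id q = case_sum ((!) bs) id (param_left J as q)"
    if "q \<in> set p" for q
    using assms that by (cases q; auto simp: param_right_def param_left_def interleave_nth)+
  then show "fill (interleave J as bs) p = fill as (map (param_right J bs) p)"
    and "fill (interleave J as bs) p = fill bs (map (param_left J as) p)"
    unfolding fill_def map_map comp_def by (intro map_cong refl; blast)+
qed

text \<open>The entries of \<open>bs\<close> avoid the subtree of the first child, so they are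
  admissible parameters there. A pattern over the interleaving thus becomes a pattern over
  \<open>as\<close>, where \<open>as\<close> may be exchanged for \<open>as'\<close>.\<close>

lemma context_type_interleave_left:
  assumes J: "J \<subseteq> {1..length as + length bs}" "card J = length as"
    and len: "length as = length as'"
    and eq: "context_type \<I> f (s @ [False]) as \<subseteq> context_type \<I> f (s @ [False]) as'"
    and bs: "\<And>b. b \<in> set bs \<Longrightarrow> \<not> prefix (s @ [False]) (f b)"
  shows "context_type \<I> f s (interleave J as bs) \<subseteq> context_type \<I> f s (interleave J as' bs)"
proof clarify
  fix R p assume p: "(R, p) \<in> context_type \<I> f s (interleave J as bs)"
  have pos: "j < length as + length bs" if "Inl j \<in> set p" for j
    using context_typeD(2)[OF p that] by simp
  let ?p = "map (param_right J bs) p"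
  have "(R, ?p) \<in> context_type \<I> f (s @ [False]) as"
  proof (rule context_typeI)
    show "(R, fill as ?p) \<in> \<I>"
      using context_typeD(1)[OF p] fill_interleave(1)[of p as bs J] pos by simp
  next
    fix j assume "Inl j \<in> set ?p"
    then obtain i where i: "Inl i \<in> set p" "Suc i \<in> J" "j = card (J \<inter> {1..<Suc i})"
      by (auto simp: param_right_def split: sum.splits if_splits)
    then show "j < length as" using interleave_index(1)[OF J, of "Suc i"] pos[OF i(1)] by simp
  next
    fix z assume "Inr z \<in> set ?p"
    then consider "Inr z \<in> set p" | i where "Inl i \<in> set p" "Suc i \<notin> J" "z = bs ! card ({1..<Suc i} - J)"
      by (auto simp: param_right_def split: sum.splits if_splits)
    then show "\<not> prefix (s @ [False]) (f z)"
    proof cases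
      case 1
      then show ?thesis using context_typeD(3)[OF p] append_prefixD by metis
    next
      case 2
      then show ?thesis using interleave_index(2)[OF J, of "Suc i"] pos[OF 2(1)] bs by simp
    qed
  qed
  then have "(R, ?p) \<in> context_type \<I> f (s @ [False]) as'" using eq by blast
  then have "(R, fill (interleave J as' bs) p) \<in> \<I>"
    using fill_interleave(1)[of p as' bs J] context_typeD(1) pos len by metis
  then show "(R, p) \<in> context_type \<I> f s (interleave J as' bs)"
    using context_typeD(3)[OF p] pos len by (intro context_typeI) auto
qed

lemma context_type_interleave_right:
  assumes J: "J \<subseteq> {1..length as + length bs}" "card J = length as"
    and len: "length bs = length bs'"
    and eq: "context_type \<I> f (s @ [True]) bs \<subseteq> context_type \<I> f (s @ [True]) bs'"
    and as: "\<And>a. a \<in> set as \<Longrightarrow> \<not> prefix (s @ [True]) (f a)"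
  shows "context_type \<I> f s (interleave J as bs) \<subseteq> context_type \<I> f s (interleave J as bs')"
proof clarify
  fix R p assume p: "(R, p) \<in> context_type \<I> f s (interleave J as bs)"
  have pos: "j < length as + length bs" if "Inl j \<in> set p" for j
    using context_typeD(2)[OF p that] by simp
  let ?p = "map (param_left J as) p"
  have "(R, ?p) \<in> context_type \<I> f (s @ [True]) bs"
  proof (rule context_typeI)
    show "(R, fill bs ?p) \<in> \<I>"
      using context_typeD(1)[OF p] fill_interleave(2)[of p as bs J] pos by simp
  next
    fix j assume "Inl j \<in> set ?p"
    then obtain i where i: "Inl i \<in> set p" "Suc i \<notin> J" "j = card ({1..<Suc i} - J)"
      by (auto simp: param_left_def split: sum.splits if_splits)
    then show "j < length bs" using interleave_index(2)[OF J, of "Suc i"] pos[OF i(1)] by simp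
  next
    fix z assume "Inr z \<in> set ?p"
    then consider "Inr z \<in> set p" | i where "Inl i \<in> set p" "Suc i \<in> J" "z = as ! card (J \<inter> {1..<Suc i})"
      by (auto simp: param_left_def split: sum.splits if_splits)
    then show "\<not> prefix (s @ [True]) (f z)"
    proof cases
      case 1
      then show ?thesis using context_typeD(3)[OF p] append_prefixD by metis
    next
      case 2
      then show ?thesis using interleave_index(1)[OF J, of "Suc i"] pos[OF 2(1)] as by simp
    qed
  qed
  then have "(R, ?p) \<in> context_type \<I> f (s @ [True]) bs'" using eq by blast
  then have "(R, fill (interleave J as bs') p) \<in> \<I>"
    using fill_interleave(2)[of p as bs' J] context_typeD(1) pos len by metis
  then show "(R, p) \<in> context_type \<I> f s (interleave J as bs')"
    using context_typeD(3)[OF p] pos len by (intro context_typeI) auto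
qed

text \<open>The type is determined by \<open>\<psi>\<close>: the components lying in
  \<open>X\<close>, and the patterns with all parameters in \<open>X\<close>. If a pattern uses a
  parameter outside \<open>X\<close>, the covering condition forces every component it uses into
  \<open>X\<close>, where \<open>keep\<close> fixes the value. The two factors of the bound count
  the lists over \<open>X\<close> with a blank and the sets of patterns.\<close>

lemma context_type_bounded:
  fixes Sg :: "('r, 'c) sig" and \<I> :: "('r, 'c, 'n) atm set"
  assumes wf: "wf_sig Sg" and inst: "is_instance Sg \<I>"
    and X: "finite X" "card X \<le> k"
    and cover: "\<And>R ts a z. \<lbrakk>(R, ts) \<in> \<I>; a \<in> set ts; z \<in> set ts; prefix s (f a); \<not> prefix s (f z)\<rbrakk>
      \<Longrightarrow> a \<in> X \<or> z \<in> X"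
  defines "N \<equiv> max_arity Sg"
  shows "finite (context_type \<I> f s ` tuples_below Sg \<I> f s) \<and>
    card (context_type \<I> f s ` tuples_below Sg \<I> f s)
      \<le> (\<Sum>i\<le>N. Suc k ^ i) * 2 ^ (card (rels Sg) * (\<Sum>i\<le>N. (N + k) ^ i))"
proof -
  let ?tup = "tuples_below Sg \<I> f s" and ?\<chi> = "context_type \<I> f s"
  define keep where "keep a = (if a \<in> X then Some a else None)" for a
  define D where "D = rels Sg \<times> {p. set p \<subseteq> {..<N} <+> X \<and> length p \<le> N}"
  define \<psi> where "\<psi> as = (map keep as, ?\<chi> as \<inter> D)" for as
  define W where "W = {xs. set xs \<subseteq> insert None (Some ` X) \<and> length xs \<le> N}"
  have finrels: "finite (rels Sg)" using wf by (simp add: wf_sig_def)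
  have sub: "?\<chi> as \<subseteq> ?\<chi> as'" if as: "as \<in> ?tup" "\<psi> as = \<psi> as'" for as as'
  proof clarify
    fix R p assume p: "(R, p) \<in> ?\<chi> as"
    have km: "map keep as = map keep as'" using as(2) by (simp add: \<psi>_def)
    have len: "length as = length as'" using map_eq_imp_length_eq[OF km] .
    have at: "(R, fill as p) \<in> \<I>" using context_typeD(1)[OF p] .
    show "(R, p) \<in> ?\<chi> as'"
    proof (cases "(R, p) \<in> D")
      case True
      moreover have "?\<chi> as \<inter> D = ?\<chi> as' \<inter> D" using as(2) by (simp add: \<psi>_def)
      ultimately have "(R, p) \<in> ?\<chi> as' \<inter> D" using p by blast
      then show ?thesis by simp
    next
      case False
      have "R \<in> rels Sg" using at inst by (auto simp: is_instance_def)
      moreover have "length p \<le> N"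
        using length_le_max_arity[OF wf inst at] by (simp add: fill_def N_def)
      \<comment> \<open>\<open>p\<close> is short enough for \<open>D\<close>, and its positions are
        below \<open>N\<close>; hence the offending entry is a parameter outside
        \<open>X\<close>.\<close>
      ultimately obtain q where q: "q \<in> set p" "q \<notin> {..<N} <+> X" using False by (auto simp: D_def)
      have "length as \<le> N" using as(1) by (simp add: tuples_below_def N_def)
      then obtain z where z: "q = Inr z" "z \<notin> X" using q context_typeD(2)[OF p]
        by (cases q) force+
      have zin: "z \<in> set (fill as p)" unfolding fill_def using q(1) z(1) by force
      have nz: "\<not> prefix s (f z)" using context_typeD(3)[OF p] q(1) z(1) by simp
      have same: "as' ! j = as ! j" if j: "Inl j \<in> set p" for j
      proof -
        have jl: "j < length as" using context_typeD(2)[OF p j] .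
        have "as ! j \<in> set (fill as p)" unfolding fill_def using j by force
        moreover have "prefix s (f (as ! j))" using as(1) nth_mem[OF jl] by (auto simp: tuples_below_def)
        ultimately have "as ! j \<in> X" using cover[OF at _ zin _ nz] z(2) by blast
        moreover have "keep (as ! j) = keep (as' ! j)" using km jl len by (metis nth_map)
        ultimately show ?thesis by (auto simp: keep_def split: if_splits)
      qed
      have "fill as' p = fill as p" unfolding fill_def
        using same by (auto split: sum.splits)
      then show ?thesis using context_typeD(2,3)[OF p] at len by (intro context_typeI) auto
    qed
  qed
  have det: "?\<chi> as = ?\<chi> as'" if "as \<in> ?tup" "as' \<in> ?tup" "\<psi> as = \<psi> as'" for as as'
    using sub[OF that(1,3)] sub[OF that(2) that(3)[symmetric]] by blast
  have finP: "finite ({..<N} <+> X)" using X by simp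
  have "card {p. set p \<subseteq> {..<N} <+> X \<and> length p \<le> N} = (\<Sum>i\<le>N. (N + card X) ^ i)"
    using card_lists_length_le[OF finP, of N] X(1) by (simp add: card_Plus)
  also have "\<dots> \<le> (\<Sum>i\<le>N. (N + k) ^ i)" using X(2) by (intro sum_mono power_mono) auto
  finally have cD: "card D \<le> card (rels Sg) * (\<Sum>i\<le>N. (N + k) ^ i)"
    by (simp add: D_def card_cartesian_product)
  have finD: "finite D" unfolding D_def using finrels finite_lists_length_le[OF finP, of N] by simp
  have finX: "finite (insert None (Some ` X))" using X by simp
  have "card W = (\<Sum>i\<le>N. Suc (card X) ^ i)"
    using card_lists_length_le[OF finX, of N] X(1) unfolding W_def
    by (simp add: card_image image_iff)
  also have "\<dots> \<le> (\<Sum>i\<le>N. Suc k ^ i)" using X(2) by (intro sum_mono power_mono) auto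
  finally have cW: "card W \<le> (\<Sum>i\<le>N. Suc k ^ i)" .
  have finW: "finite W" unfolding W_def using finite_lists_length_le[OF finX, of N] .
  have sub\<psi>: "\<psi> ` ?tup \<subseteq> W \<times> Pow D"
    by (auto simp: \<psi>_def W_def keep_def tuples_below_def N_def)
  have fin\<psi>: "finite (W \<times> Pow D)" using finW finD by simp
  have "card (\<psi> ` ?tup) \<le> card (W \<times> Pow D)" using card_mono[OF fin\<psi> sub\<psi>] .
  also have "\<dots> = card W * 2 ^ card D" using finD by (simp add: card_cartesian_product card_Pow)
  also have "\<dots> \<le> (\<Sum>i\<le>N. Suc k ^ i) * 2 ^ (card (rels Sg) * (\<Sum>i\<le>N. (N + k) ^ i))"
    using cW cD by (intro mult_le_mono power_increasing) auto
  finally have "card (\<psi> ` ?tup) \<le> (\<Sum>i\<le>N. Suc k ^ i) * 2 ^ (card (rels Sg) * (\<Sum>i\<le>N. (N + k) ^ i))" .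
  then show ?thesis
    using card_image_le_if_determined[of ?tup \<psi> ?\<chi>, OF det finite_subset[OF sub\<psi> fin\<psi>]]
    by (meson order_trans)
qed

text \<open>Context types form an invariant coloring, and small separators bound their number at
  every node.\<close>

lemma finite_partitionwidth_if_separators:
  fixes Sg :: "('r, 'c) sig" and \<I> :: "('r, 'c, 'n) atm set" and f :: "('c, 'n) trm \<Rightarrow> node"
  assumes wf: "wf_sig Sg" and inst: "is_instance Sg \<I>"
    and antichain: "\<And>t t'. \<lbrakk>t \<in> adom \<I>; t' \<in> adom \<I>; prefix (f t) (f t')\<rbrakk> \<Longrightarrow> t = t'"
    and separator: "\<And>s. \<exists>X. finite X \<and> card X \<le> k \<and>
      (\<forall>R ts a z. (R, ts) \<in> \<I> \<longrightarrow> a \<in> set ts \<longrightarrow> z \<in> set ts \<longrightarrow> prefix s (f a) \<longrightarrow> prefix s (f z) \<or> a \<in> X \<or> z \<in> X)"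
  shows "finite_partitionwidth Sg \<I>"
proof -
  \<comment> \<open>Only proper descendants of a node are available to \<open>Mat\<close>, hence the extra edge at the root.\<close>
  define g where "g t = False # f t" for t
  let ?tup = "tuples_below Sg \<I> g" and ?\<chi> = "context_type \<I> g"
  define N where "N = max_arity Sg"
  define B where "B = (\<Sum>i\<le>N. Suc k ^ i) * 2 ^ (card (rels Sg) * (\<Sum>i\<le>N. (N + k) ^ i))"
  have bounded: "finite (?\<chi> s ` ?tup s) \<and> card (?\<chi> s ` ?tup s) \<le> B" for s
  proof -
    have "\<exists>X. finite X \<and> card X \<le> k \<and>
      (\<forall>R ts a z. (R, ts) \<in> \<I> \<longrightarrow> a \<in> set ts \<longrightarrow> z \<in> set ts \<longrightarrow> prefix s (g a) \<longrightarrow> prefix s (g z) \<or> a \<in> X \<or> z \<in> X)"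
    proof (cases s)
      \<comment> \<open>Nothing lies outside the subtree at the root, so the empty separator
        works.\<close>
      case Nil
      then show ?thesis by (intro exI[of _ "{}"]) simp
    next
      case (Cons b s')
      obtain X where X: "finite X" "card X \<le> k"
          "\<forall>R ts a z. (R, ts) \<in> \<I> \<longrightarrow> a \<in> set ts \<longrightarrow> z \<in> set ts \<longrightarrow> prefix s' (f a) \<longrightarrow> prefix s' (f z) \<or> a \<in> X \<or> z \<in> X"
        using separator[of s'] by blast
      show ?thesis
        using X(3) by (intro exI[of _ X] conjI X) (auto simp: g_def Cons)
    qed
    then obtain X where X: "finite X" "card X \<le> k"
        and c: "\<forall>R ts a z. (R, ts) \<in> \<I> \<longrightarrow> a \<in> set ts \<longrightarrow> z \<in> set ts \<longrightarrow> prefix s (g a) \<longrightarrow> prefix s (g z) \<or> a \<in> X \<or> z \<in> X"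
      by blast
    show ?thesis unfolding B_def N_def
      using c by (intro context_type_bounded[OF wf inst X]) fast
  qed
  have apart: "\<not> prefix (s @ [\<not> i]) (g t)" if "as \<in> ?tup (s @ [i])" "t \<in> set as" for s i t as
    using that by (auto simp: tuples_below_def prefix_def)
  interpret invariant_coloring Sg \<I> g ?\<chi> B
  proof
    show "is_instance Sg \<I>" by fact
    show "finite (?\<chi> s ` ?tup s) \<and> card (?\<chi> s ` ?tup s) \<le> B" for s by (rule bounded)
    fix t t' assume "t \<in> adom \<I>" "t' \<in> adom \<I>" "prefix (g t) (g t')"
    then show "t = t'" using antichain[of t t'] by (simp add: g_def)
  next
    fix s i as as'
    assume "length as = length as'" "?\<chi> (s @ [i]) as = ?\<chi> (s @ [i]) as'"
    then show "?\<chi> s as = ?\<chi> s as'"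
      using context_type_child_mono[of as as' \<I> g s i] context_type_child_mono[of as' as \<I> g s i] by simp
  next
    fix s J as as' bs bs'
    assume h: "as \<in> ?tup (s @ [False])" "as' \<in> ?tup (s @ [False])" "bs \<in> ?tup (s @ [True])"
      "bs' \<in> ?tup (s @ [True])" "length as = length as'" "?\<chi> (s @ [False]) as = ?\<chi> (s @ [False]) as'"
      "length bs = length bs'" "?\<chi> (s @ [True]) bs = ?\<chi> (s @ [True]) bs'"
      "J \<subseteq> {1..length as + length bs}" "card J = length as"
    have bs_apart: "\<not> prefix (s @ [False]) (g b)" if "b \<in> set bs" for b
      using apart[OF h(3) that] by simp
    have as'_apart: "\<not> prefix (s @ [True]) (g a)" if "a \<in> set as'" for a
      using apart[OF h(2) that] by simp
    have J': "J \<subseteq> {1..length as' + length bs}" "card J = length as'"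
      and J'': "J \<subseteq> {1..length as' + length bs'}" "card J = length as'"
      using h(5,7,9,10) by simp_all
    \<comment> \<open>The two parts are exchanged one after the other, the fixed part serving as
      parameters.\<close>
    have "?\<chi> s (interleave J as bs) = ?\<chi> s (interleave J as' bs)"
      using context_type_interleave_left[OF h(9,10,5) equalityD1[OF h(6)] bs_apart]
        context_type_interleave_left[OF J' h(5)[symmetric] equalityD2[OF h(6)] bs_apart]
      by (rule subset_antisym)
    also have "\<dots> = ?\<chi> s (interleave J as' bs')"
      using context_type_interleave_right[OF J' h(7) equalityD1[OF h(8)] as'_apart]
        context_type_interleave_right[OF J'' h(7)[symmetric] equalityD2[OF h(8)] as'_apart]
      by (rule subset_antisym)
    finally show "?\<chi> s (interleave J as bs) = ?\<chi> s (interleave J as' bs')" .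
  next
    fix R ts assume at: "(R, ts) \<in> \<I>"
    \<comment> \<open>The pattern listing all positions in order reproduces the tuple, so its
      presence in the type at the node \<open>[False]\<close>, below which all terms lie, decides
      the atom.\<close>
    let ?p = "map Inl [0..<length ts]"
    have fill: "fill ts' ?p = ts'" if "length ts' = length ts" for ts'
      using that by (intro nth_equalityI) (simp_all add: fill_def)
    have "ts \<in> ?tup ([] @ [False])"
      using length_le_max_arity[OF wf inst at] by (auto simp: tuples_below_def g_def)
    moreover have "(R, ts') \<in> \<I>"
      if "length ts' = length ts" "?\<chi> ([] @ [False]) ts' = ?\<chi> ([] @ [False]) ts" for ts'
    proof -
      have "(R, ?p) \<in> ?\<chi> ([] @ [False]) ts"
        using at fill[of ts] by (intro context_typeI) auto
      then have "(R, ?p) \<in> ?\<chi> ([] @ [False]) ts'" unfolding that(2) .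
      from context_typeD(1)[OF this] show ?thesis by (simp only: fill[OF that(1)])
    qed
    ultimately show "(\<exists>t. R = univ Sg \<and> ts = [t]) \<or> (\<exists>s i. ts \<in> ?tup (s @ [i]) \<and>
        (\<forall>ts'\<in>?tup (s @ [i]). length ts' = length ts \<longrightarrow> ?\<chi> (s @ [i]) ts' = ?\<chi> (s @ [i]) ts \<longrightarrow> (R, ts') \<in> \<I>))"
      by blast
  qed
  show ?thesis by (rule finite_partitionwidth)
qed

section \<open>Rooted trees\<close>

text \<open>\<open>d\<close> is the distance from \<open>r\<close> and \<open>\<pi>\<close> picks a
  neighbor closer to \<open>r\<close>. An edge joining no vertex to its parent would close a cycle
  with the two ancestor chains of its ends.\<close>

lemma is_tree_parent:
  assumes tree: "is_tree V E" and r: "r \<in> V"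
  obtains \<pi> and d :: "'v \<Rightarrow> nat" where
    "\<And>X. \<lbrakk>X \<in> V; X \<noteq> r\<rbrakk> \<Longrightarrow> \<pi> X \<in> V \<and> (X, \<pi> X) \<in> E \<and> d X = Suc (d (\<pi> X))"
    "d r = 0"
    "\<And>X Y. (X, Y) \<in> E \<Longrightarrow> X \<noteq> r \<and> \<pi> X = Y \<or> Y \<noteq> r \<and> \<pi> Y = X"
proof -
  have EV: "E \<subseteq> V \<times> V" and symE: "sym E" and irr: "irrefl E" and acyc: "\<nexists>vs. is_cycle E vs"
    and conn: "induced_connected E V"
    using tree by (simp_all add: is_tree_def)
  define d where "d X = (LEAST n. (r, X) \<in> E ^^ n)" for X
  have reach: "(r, X) \<in> E ^^ d X" if "X \<in> V" for X
  proof -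
    have "(r, X) \<in> (E \<inter> V \<times> V)\<^sup>*" using conn r that by (simp add: induced_connected_def)
    then have "(r, X) \<in> E\<^sup>*" by (rule rtrancl_mono[THEN subsetD, rotated]) blast
    then obtain n where "(r, X) \<in> E ^^ n" using rtrancl_imp_relpow by blast
    then show ?thesis unfolding d_def by (rule LeastI)
  qed
  have d_le: "d X \<le> n" if "(r, X) \<in> E ^^ n" for X n
    unfolding d_def using that by (rule Least_le)
  have d_r: "d r = 0" using d_le[of r 0] by simp
  have d0: "X = r" if "X \<in> V" "d X = 0" for X using reach[OF that(1)] that(2) by simp
  have "\<exists>Y. Y \<in> V \<and> (X, Y) \<in> E \<and> d X = Suc (d Y)" if X: "X \<in> V" "X \<noteq> r" for X
  proof -
    obtain n where n: "d X = Suc n" using d0 X not0_implies_Suc by blast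
    \<comment> \<open>\<open>Y\<close> is the last vertex before \<open>X\<close> on a shortest walk
      from \<open>r\<close>.\<close>
    then obtain Y where Y: "(r, Y) \<in> E ^^ n" "(Y, X) \<in> E" using reach[OF X(1)] by auto
    have "Y \<in> V" using Y(2) EV by blast
    have "(r, X) \<in> E ^^ Suc (d Y)" using reach[OF \<open>Y \<in> V\<close>] Y(2) by auto
    then have "d X \<le> Suc (d Y)" by (rule d_le)
    moreover have "d Y \<le> n" using Y(1) by (rule d_le)
    ultimately have "d X = Suc (d Y)" using n by simp
    then show ?thesis using \<open>Y \<in> V\<close> Y(2) symE by (auto dest: symD)
  qed
  then obtain \<pi> where \<pi>: "\<pi> X \<in> V \<and> (X, \<pi> X) \<in> E \<and> d X = Suc (d (\<pi> X))" if "X \<in> V" "X \<noteq> r" for X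
    by metis
  have anc: "(\<pi> ^^ i) X \<in> V \<and> d ((\<pi> ^^ i) X) + i = d X" if "X \<in> V" "i \<le> d X" for X i
    using that(2)
  proof (induction i)
    case 0
    then show ?case using that by simp
  next
    case (Suc i)
    then have IH: "(\<pi> ^^ i) X \<in> V" "d ((\<pi> ^^ i) X) + i = d X" by auto
    then have "(\<pi> ^^ i) X \<noteq> r" using Suc.prems d_r by auto
    then show ?case using \<pi>[OF IH(1)] IH(2) by simp
  qed
  have anc_edge: "((\<pi> ^^ i) X, (\<pi> ^^ Suc i) X) \<in> E" if "X \<in> V" "i < d X" for X i
  proof -
    have "(\<pi> ^^ i) X \<noteq> r" using anc[OF that(1), of i] that(2) d_r by auto
    then show ?thesis using \<pi> anc[OF that(1), of i] that(2) by simp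
  qed
  have anc_inj: "inj_on (\<lambda>i. (\<pi> ^^ i) X) {..d X}" if "X \<in> V" for X
  proof (rule inj_onI)
    fix i j assume "i \<in> {..d X}" "j \<in> {..d X}" "(\<pi> ^^ i) X = (\<pi> ^^ j) X"
    then show "i = j" using anc[OF that, of i] anc[OF that, of j] by simp
  qed
  have anc_path: "successively (\<lambda>u v. (u, v) \<in> E) (map (\<lambda>i. (\<pi> ^^ i) X) [0..<n])"
    if "X \<in> V" "n \<le> Suc (d X)" for X n
    unfolding successively_conv_nth using anc_edge[OF that(1)] that(2) by auto
  have "X \<noteq> r \<and> \<pi> X = Y \<or> Y \<noteq> r \<and> \<pi> Y = X" if e: "(X, Y) \<in> E" for X Y
  proof -
    have X: "X \<in> V" and Y: "Y \<in> V" using e EV by auto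
    define meet where "meet i j \<longleftrightarrow> i \<le> d X \<and> j \<le> d Y \<and> (\<pi> ^^ i) X = (\<pi> ^^ j) Y" for i j
    have "(\<pi> ^^ d X) X = r" "(\<pi> ^^ d Y) Y = r" using anc[OF X, of "d X"] anc[OF Y, of "d Y"] d0 by auto
    then have ex: "\<exists>i. \<exists>j. meet i j" unfolding meet_def by (intro exI[of _ "d X"] exI[of _ "d Y"]) simp
    \<comment> \<open>The pair \<open>(i, j)\<close> is the lexicographically least meeting, which
      makes the two chains disjoint up to the meeting point.\<close>
    define i where "i = (LEAST i. \<exists>j. meet i j)"
    have exi: "\<exists>j. meet i j" unfolding i_def using ex by (rule LeastI_ex)
    have mini: "\<not> meet i' j" if "i' < i" for i' j using not_less_Least[OF that[unfolded i_def]] by blast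
    define j where "j = (LEAST j. meet i j)"
    have m: "meet i j" unfolding j_def using exi by (rule LeastI_ex)
    have minj: "\<not> meet i j'" if "j' < j" for j' using not_less_Least[OF that[unfolded j_def]] .
    have ij: "i \<le> d X" "j \<le> d Y" "(\<pi> ^^ i) X = (\<pi> ^^ j) Y" using m by (auto simp: meet_def)
    \<comment> \<open>\<open>xs\<close> includes the meeting point and \<open>ys\<close> stops
      before it, so \<open>xs @ rev ys\<close> is a path from \<open>X\<close> to \<open>Y\<close>,
      closed by the given edge.\<close>
    define xs where "xs = map (\<lambda>i. (\<pi> ^^ i) X) [0..<Suc i]"
    define ys where "ys = map (\<lambda>j. (\<pi> ^^ j) Y) [0..<j]"
    have xs: "xs \<noteq> []" "hd xs = X" "last xs = (\<pi> ^^ i) X" "length xs = Suc i"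
      by (simp_all add: xs_def hd_map last_map del: upt_Suc)
    have "distinct xs" "distinct ys"
      unfolding xs_def ys_def distinct_map set_upt using ij(1,2)
      by (auto simp del: upt_Suc intro!: inj_on_subset[OF anc_inj[OF X]] inj_on_subset[OF anc_inj[OF Y]])
    moreover have "set xs \<inter> set ys = {}"
    proof (rule ccontr)
      assume "set xs \<inter> set ys \<noteq> {}"
      then obtain i' j' where "i' \<le> i" "j' < j" "(\<pi> ^^ i') X = (\<pi> ^^ j') Y"
        by (auto simp: xs_def ys_def less_Suc_eq_le simp del: upt_Suc)
      then have "meet i' j'" using ij by (simp add: meet_def)
      then show False using mini minj \<open>i' \<le> i\<close> \<open>j' < j\<close> by (metis le_neq_implies_less)
    qed
    ultimately have dist: "distinct (xs @ rev ys)" by auto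
    have "successively (\<lambda>u v. (u, v) \<in> E) xs" unfolding xs_def using anc_path[OF X, of "Suc i"] ij(1) by simp
    moreover have "successively (\<lambda>u v. (u, v) \<in> E) (rev ys)"
    proof -
      have "successively (\<lambda>u v. (u, v) \<in> E) ys" unfolding ys_def using anc_path[OF Y, of j] ij(2) by simp
      then show ?thesis unfolding successively_rev
        by (rule successively_mono) (use symE in \<open>auto dest: symD\<close>)
    qed
    moreover have "(last xs, hd (rev ys)) \<in> E" if "ys \<noteq> []"
    proof -
      obtain j' where j': "j = Suc j'" using \<open>ys \<noteq> []\<close> by (cases j) (auto simp: ys_def)
      then have "hd (rev ys) = (\<pi> ^^ j') Y" by (simp add: ys_def hd_rev)
      then show ?thesis using anc_edge[OF Y, of j'] j' ij xs(3) symE by (auto dest: symD)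
    qed
    ultimately have succ: "successively (\<lambda>u v. (u, v) \<in> E) (xs @ rev ys)"
      by (auto simp: successively_append_iff)
    have "last (xs @ rev ys) = Y"
    proof (cases j)
      case 0
      then show ?thesis using xs(3) ij(3) by (simp add: ys_def)
    next
      case (Suc j')
      then show ?thesis by (simp add: ys_def last_rev hd_map del: upt_Suc)
    qed
    moreover have "hd (xs @ rev ys) = X" using xs by simp
    ultimately have "(last (xs @ rev ys), hd (xs @ rev ys)) \<in> E" using e symE by (auto dest: symD)
    \<comment> \<open>The closed path has \<open>i + j + 1\<close> vertices and must be too short
      for a cycle.\<close>
    then have "\<not> 3 \<le> length (xs @ rev ys)" using acyc dist succ unfolding is_cycle_def by blast
    then have "i + j < 2" using xs(4) by (simp add: ys_def)
    moreover have "X \<noteq> Y" using e irr by (auto simp: irrefl_def)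
    ultimately consider "i = 1" "j = 0" | "i = 0" "j = 1" using ij(3) by (cases i; cases j) auto
    then show ?thesis using ij d_r by cases auto
  qed
  then show thesis using that[of \<pi> d] \<pi> d_r by blast
qed

section \<open>A binary prefix code\<close>

text \<open>Embeds the countably branching tree of number words into the binary tree: the children
  of a word hang off a ray of \<open>True\<close> steps.\<close>

definition unary_code :: "nat list \<Rightarrow> bool list" where
  "unary_code ns = concat (map (\<lambda>n. replicate n True @ [False]) ns)"

lemma unary_code_simps [simp]:
  "unary_code [] = []" "unary_code (n # ns) = replicate n True @ False # unary_code ns"
  by (simp_all add: unary_code_def)

lemma prefix_unary_token:
  "prefix (replicate m True @ False # u) (replicate n True @ False # v) \<longleftrightarrow> m = n \<and> prefix u v"
proof (induction m arbitrary: n)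
  case 0
  then show ?case by (cases n) auto
next
  case (Suc m)
  then show ?case by (cases n) auto
qed

lemma prefix_replicate_unary_token:
  "prefix (replicate m True) (replicate n True @ False # v) \<longleftrightarrow> m \<le> n"
proof (induction m arbitrary: n)
  case (Suc m)
  then show ?case by (cases n) auto
qed simp

text \<open>Complete tokens are peeled off one by one. Below the binary node lie exactly the words
  extending \<open>u\<close> by a letter at least \<open>m\<close>, and \<open>u\<close> itself if
  \<open>m = 0\<close>.\<close>

lemma prefix_unary_code:
  "prefix (unary_code u @ replicate m True) (unary_code v) \<longleftrightarrow>
     m = 0 \<and> v = u \<or> (\<exists>n r. v = u @ n # r \<and> m \<le> n)"
proof (induction u arbitrary: v)
  case Nil
  then show ?case by (cases v) (auto simp: prefix_replicate_unary_token)
next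
  case (Cons x u)
  show ?case
  proof (cases v)
    case (Cons y v')
    then show ?thesis using Cons.IH[of v'] by (auto simp: prefix_unary_token)
  qed simp
qed

text \<open>Each \<open>False\<close> ends a token; the trailing \<open>True\<close>s form an
  incomplete one.\<close>

lemma unary_code_decomp: "\<exists>u m. s = unary_code u @ replicate m True"
proof (induction s rule: rev_induct)
  case Nil
  show ?case by (intro exI[of _ "[]"] exI[of _ 0]) simp
next
  case (snoc b s)
  then obtain u m where s: "s = unary_code u @ replicate m True" by blast
  show ?case
  proof (cases b)
    case True
    then show ?thesis
      using s by (intro exI[of _ u] exI[of _ "Suc m"]) (simp add: replicate_append_same)
  next
    case False
    then show ?thesis
      using s by (intro exI[of _ "u @ [m]"] exI[of _ 0]) (simp add: unary_code_def)
  qed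
qed

section \<open>Treewidth\<close>

text \<open>The letters of the bags on the way down to \<open>X\<close>, beginning below its
  \<open>n\<close>-th ancestor. The counter makes the recursion along \<open>\<pi>\<close>
  primitive; it is set to the depth of \<open>X\<close>.\<close>

primrec path_word :: "('v \<Rightarrow> nat) \<Rightarrow> ('v \<Rightarrow> 'v) \<Rightarrow> nat \<Rightarrow> 'v \<Rightarrow> nat list" where
  "path_word \<nu> \<pi> 0 X = []"
| "path_word \<nu> \<pi> (Suc n) X = path_word \<nu> \<pi> n (\<pi> X) @ [\<nu> X]"

text \<open>Supplies the separators: a binary node selects a bag \<open>Z\<close> and some of the
  subtrees hanging below it, and \<open>Z\<close> separates the terms placed there from the
  rest.\<close>

lemma finite_partitionwidth_if_finite_treewidth:
  fixes Sg :: "('r, 'c) sig" and \<I> :: "('r, 'c, 'n) atm set"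
  assumes wf: "wf_sig Sg" and inst: "is_instance Sg \<I>" and tw: "finite_treewidth \<I>"
  shows "finite_partitionwidth Sg \<I>"
proof -
  obtain V E k where td: "tree_decomposition \<I> V E" and k: "\<And>X. X \<in> V \<Longrightarrow> finite X \<and> card X \<le> k"
    using tw unfolding finite_treewidth_def by blast
  have tree: "is_tree V E" and UV: "\<Union>V = adom \<I>"
    and bags: "\<And>R ts. (R, ts) \<in> \<I> \<Longrightarrow> \<exists>X\<in>V. set ts \<subseteq> X"
    and conn: "\<And>t. t \<in> adom \<I> \<Longrightarrow> induced_connected E {X \<in> V. t \<in> X}"
    using td unfolding tree_decomposition_def by auto
  have EV: "E \<subseteq> V \<times> V" and "V \<noteq> {}" using tree by (simp_all add: is_tree_def)
  then obtain r where r: "r \<in> V" by blast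
  obtain \<pi> and d :: "('c, 'n) trm set \<Rightarrow> nat" where
    parent: "\<And>X. \<lbrakk>X \<in> V; X \<noteq> r\<rbrakk> \<Longrightarrow> \<pi> X \<in> V \<and> (X, \<pi> X) \<in> E \<and> d X = Suc (d (\<pi> X))"
    and d_r: "d r = 0"
    and edge: "\<And>X Y. (X, Y) \<in> E \<Longrightarrow> X \<noteq> r \<and> \<pi> X = Y \<or> Y \<noteq> r \<and> \<pi> Y = X"
    using is_tree_parent[OF tree r] by blast
  have cI: "countable \<I>" using inst by (simp add: is_instance_def)
  have cdom: "countable (adom \<I>)"
    unfolding adom_def case_prod_unfold by (intro countable_UN[OF cI] countable_finite) simp
  have "V \<subseteq> {X. finite X \<and> X \<subseteq> adom \<I>}" using k UV by blast
  then have cV: "countable V"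
    using countable_Collect_finite_subset[OF cdom] countable_subset by blast
  have dom: "set ts \<subseteq> adom \<I>" if "(R, ts) \<in> \<I>" for R ts
    using length_le_max_arity[OF wf inst that] by simp
  \<comment> \<open>Bags get even letters and terms odd ones, so a term letter never occurs in the
    word of a bag.\<close>
  define \<nu> where "\<nu> X = 2 * to_nat_on V X" for X
  define \<mu> where "\<mu> t = 2 * to_nat_on (adom \<I>) t + 1" for t
  have \<nu>_inj: "X = Y" if "X \<in> V" "Y \<in> V" "\<nu> X = \<nu> Y" for X Y
    using that inj_on_to_nat_on[OF cV] by (simp add: \<nu>_def inj_on_def)
  have \<mu>_inj: "t = t'" if "t \<in> adom \<I>" "t' \<in> adom \<I>" "\<mu> t = \<mu> t'" for t t'
    using that inj_on_to_nat_on[OF cdom] by (simp add: \<mu>_def inj_on_def)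
  define w where "w X = path_word \<nu> \<pi> (d X) X" for X
  have w_r: "w r = []" by (simp add: w_def d_r)
  have w_step: "w X = w (\<pi> X) @ [\<nu> X]" if "X \<in> V" "X \<noteq> r" for X
    using parent[OF that] by (simp add: w_def)
  have w_ne: "w X \<noteq> []" if "X \<in> V" "X \<noteq> r" for X
    unfolding w_step[OF that] by simp
  \<comment> \<open>\<open>\<nu>\<close> is injective on all bags, not only among siblings, so the
    last letter already identifies the bag.\<close>
  have w_inj: "X = Y" if "X \<in> V" "Y \<in> V" "w X = w Y" for X Y
  proof (cases "X = r \<or> Y = r")
    case True
    then show ?thesis using that w_ne w_r by metis
  next
    case False
    then have XY: "X \<noteq> r" "Y \<noteq> r" by auto
    have "w (\<pi> X) @ [\<nu> X] = w (\<pi> Y) @ [\<nu> Y]"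
      using that(3) unfolding w_step[OF that(1) XY(1)] w_step[OF that(2) XY(2)] .
    then show ?thesis using \<nu>_inj[OF that(1,2)] by simp
  qed
  have "even x" if "x \<in> set (path_word \<nu> \<pi> n X)" for x n X
    using that by (induction n arbitrary: X) (auto simp: \<nu>_def)
  then have \<mu>_w: "\<mu> t \<notin> set (w X)" for t X
    unfolding w_def \<mu>_def by (metis even_plus_one_iff dvd_triv_left)
  \<comment> \<open>Prefixes of the word of a bag are the words of its ancestors.\<close>
  have w_prefix: "\<exists>Z\<in>V. u = w Z" if "X \<in> V" "w X = u @ v" for X u v
    using that
  proof (induction "d X" arbitrary: X v)
    case 0
    then have "X = r" using parent[of X] by auto
    then show ?case using 0(3) w_r r by (intro bexI[of _ r]) auto
  next
    case (Suc n)
    show ?case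
    proof (cases v rule: rev_cases)
      case Nil
      then show ?thesis using Suc.prems by auto
    next
      case (snoc v' x)
      have "X \<noteq> r" using Suc.hyps(2) d_r by auto
      note X = \<open>X \<in> V\<close> this
      have "n = d (\<pi> X)" "\<pi> X \<in> V" using parent[OF X] Suc.hyps(2) by simp_all
      moreover have "w (\<pi> X) @ [\<nu> X] = (u @ v') @ [x]"
        using Suc.prems(2) unfolding w_step[OF X] snoc by simp
      ultimately show ?thesis using Suc.hyps(1) unfolding append1_eq_conv by blast
    qed
  qed
  define bag where "bag t = (SOME X. X \<in> V \<and> t \<in> X)" for t
  have bag: "bag t \<in> V" "t \<in> bag t" if "t \<in> adom \<I>" for t
  proof -
    have "\<exists>X. X \<in> V \<and> t \<in> X" using that UV by blast
    from someI_ex[OF this] show "bag t \<in> V" "t \<in> bag t" by (simp_all add: bag_def)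
  qed
  define word where "word t = w (bag t) @ [\<mu> t]" for t
  define f where "f t = unary_code (word t)" for t
  have antichain: "t = t'" if "t \<in> adom \<I>" "t' \<in> adom \<I>" "prefix (f t) (f t')" for t t'
  proof -
    have "word t' = word t \<or> (\<exists>n v. word t' = word t @ n # v)"
      using that(3) prefix_unary_code[of "word t" 0 "word t'"] by (auto simp: f_def)
    \<comment> \<open>A proper extension would place the odd letter \<open>\<mu> t\<close> inside
      the word of a bag.\<close>
    moreover have False if "word t' = word t @ n # v" for n v
    proof -
      have "w (bag t') @ [\<mu> t'] = (w (bag t) @ \<mu> t # butlast (n # v)) @ [last (n # v)]"
        using that by (simp add: word_def)
      then have "w (bag t') = w (bag t) @ \<mu> t # butlast (n # v)" unfolding append1_eq_conv by simp
      then have "\<mu> t \<in> set (w (bag t'))" by simp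
      then show False using \<mu>_w by blast
    qed
    ultimately have "\<mu> t' = \<mu> t" by (auto simp: word_def)
    then show ?thesis using \<mu>_inj that by metis
  qed
  \<comment> \<open>\<open>Suc k\<close> leaves room for the singleton used when \<open>s\<close> is
    the position of a term.\<close>
  have "\<exists>X. finite X \<and> card X \<le> Suc k \<and> (\<forall>R ts a z. (R, ts) \<in> \<I> \<longrightarrow> a \<in> set ts \<longrightarrow> z \<in> set ts \<longrightarrow>
      prefix s (f a) \<longrightarrow> prefix s (f z) \<or> a \<in> X \<or> z \<in> X)" for s
  proof (cases "\<exists>a\<in>adom \<I>. prefix s (f a)")
    case False
    then show ?thesis using dom by (intro exI[of _ "{}"] conjI) (simp, simp, blast)
  next
    case True
    then obtain a0 where a0: "a0 \<in> adom \<I>" "prefix s (f a0)" by blast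
    obtain u m where s: "s = unary_code u @ replicate m True" using unary_code_decomp by blast
    have below: "prefix s (f a) \<longleftrightarrow> m = 0 \<and> word a = u \<or> (\<exists>n v. word a = u @ n # v \<and> m \<le> n)" for a
      unfolding s f_def by (rule prefix_unary_code)
    show ?thesis
    proof (cases "m = 0 \<and> word a0 = u")
      case True
      then have "s = f a0" by (simp add: s f_def)
      then have "a \<in> {a0}" if "(R, ts) \<in> \<I>" "a \<in> set ts" "prefix s (f a)" for R ts a
        using that antichain[OF a0(1), of a] dom by blast
      then show ?thesis by (intro exI[of _ "{a0}"] conjI) (simp, simp, blast)
    next
      case False
      then obtain n v where nv: "word a0 = u @ n # v" using a0(2) below[of a0] by blast
      \<comment> \<open>Dropping the final letter \<open>\<mu> a0\<close> shows that
        \<open>u\<close> is a prefix of the word of a bag, hence itself the word of a bag.\<close>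
      then have "w (bag a0) @ [\<mu> a0] = (u @ butlast (n # v)) @ [last (n # v)]" by (simp add: word_def)
      then have "w (bag a0) = u @ butlast (n # v)" unfolding append1_eq_conv by simp
      then obtain Z where Z: "Z \<in> V" "u = w Z" using w_prefix bag(1)[OF a0(1)] by blast
      \<comment> \<open>Removing the bag \<open>Z\<close> disconnects the bags \<open>Y\<close> with \<open>Q Y\<close> from all others.\<close>
      define Q where "Q Y \<longleftrightarrow> (\<exists>n v. w Y = u @ n # v \<and> m \<le> n)" for Y
      \<comment> \<open>Child and parent words differ only in the last letter; this affects
        \<open>Q\<close> only if the parent word is \<open>u\<close>, that is, if the parent is
        \<open>Z\<close>.\<close>
      have Q_parent: "Q (\<pi> Y) \<longleftrightarrow> Q Y" if Y: "Y \<in> V" "Y \<noteq> r" "\<pi> Y \<noteq> Z" for Y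
      proof
        assume "Q (\<pi> Y)"
        then show "Q Y" unfolding Q_def w_step[OF Y(1,2)] by auto
      next
        assume "Q Y"
        then obtain n v where "w (\<pi> Y) @ [\<nu> Y] = u @ n # v" "m \<le> n"
          unfolding Q_def w_step[OF Y(1,2)] by blast
        moreover have "w (\<pi> Y) \<noteq> u" using w_inj[of "\<pi> Y" Z] parent[OF Y(1,2)] Z Y(3) by blast
        ultimately show "Q (\<pi> Y)" unfolding Q_def by (cases v rule: rev_cases) auto
      qed
      have Q_edge: "Q Y \<longleftrightarrow> Q Y'" if e: "(Y, Y') \<in> E" "Y \<noteq> Z" "Y' \<noteq> Z" for Y Y'
        using edge[OF e(1)] Q_parent[of Y] Q_parent[of Y'] EV e by auto
      \<comment> \<open>The bags containing \<open>t\<close> are connected and avoid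
        \<open>Z\<close>, so \<open>Q\<close> is constant on them.\<close>
      have Q_conn: "Q Y \<longleftrightarrow> Q Y'"
        if t: "t \<in> adom \<I>" "t \<notin> Z" and Y: "Y \<in> V" "t \<in> Y" "Y' \<in> V" "t \<in> Y'" for t Y Y'
      proof -
        let ?W = "{X \<in> V. t \<in> X}"
        have "(Y, Y') \<in> (E \<inter> ?W \<times> ?W)\<^sup>*" using conn[OF t(1)] Y unfolding induced_connected_def by blast
        then show ?thesis
        proof induction
          case (step Y1 Y2)
          then have "(Y1, Y2) \<in> E" "Y1 \<noteq> Z" "Y2 \<noteq> Z" using t(2) by auto
          then show ?case using Q_edge step.IH by blast
        qed simp
      qed
      \<comment> \<open>The word of \<open>a\<close> extends that of its bag by one odd letter. That
        letter could only matter if the bag were \<open>Z\<close>, which \<open>a \<notin> Z\<close>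
        excludes.\<close>
      have below_Q: "prefix s (f a) \<longleftrightarrow> Q (bag a)" if a: "a \<in> adom \<I>" "a \<notin> Z" for a
      proof
        have ne: "w (bag a) \<noteq> u" using w_inj[of "bag a" Z] bag[OF a(1)] Z a(2) by blast
        have "\<mu> a \<in> set (word a)" by (simp add: word_def)
        then have nu: "word a \<noteq> u" using \<mu>_w[of a Z] Z(2) by metis
        assume "prefix s (f a)"
        then obtain n v where "w (bag a) @ [\<mu> a] = u @ n # v" "m \<le> n"
          using below[of a] nu by (auto simp: word_def)
        then show "Q (bag a)" using ne unfolding Q_def by (cases v rule: rev_cases) auto
      next
        assume "Q (bag a)"
        then show "prefix s (f a)" unfolding below Q_def word_def by auto
      qed
      have "prefix s (f z) \<or> a \<in> Z \<or> z \<in> Z"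
        if at: "(R, ts) \<in> \<I>" "a \<in> set ts" "z \<in> set ts" "prefix s (f a)" for R ts a z
      proof (rule ccontr)
        assume n: "\<not> ?thesis"
        have az: "a \<in> adom \<I>" "z \<in> adom \<I>" using at dom by blast+
        \<comment> \<open>The bag of the atom contains both \<open>a\<close> and \<open>z\<close>
          and carries \<open>Q\<close> over from \<open>bag a\<close> to
          \<open>bag z\<close>.\<close>
        obtain Y where Y: "Y \<in> V" "set ts \<subseteq> Y" using bags[OF at(1)] by blast
        have "Q (bag a)" using below_Q[OF az(1)] at(4) n by blast
        then have "Q Y" using Q_conn[of a "bag a" Y] az bag n Y at(2) by blast
        then have "Q (bag z)" using Q_conn[of z Y "bag z"] az bag n Y at(3) by blast
        then show False using below_Q[OF az(2)] n by blast
      qed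
      then show ?thesis using k[OF Z(1)] by (intro exI[of _ Z]) auto
    qed
  qed
  then show ?thesis using finite_partitionwidth_if_separators[OF wf inst antichain] by blast
qed

theorem mainTheorem8:
  fixes Sg :: "('r, 'c) sig" and \<I> :: "('r, 'c, 'n) atm set"
  assumes "wf_sig Sg" and "is_instance Sg \<I>"
  shows "(finite_treewidth \<I> \<longrightarrow> finite_partitionwidth Sg \<I>) \<and>
         (finite_cliquewidth Sg \<I> \<longrightarrow> finite_partitionwidth Sg \<I>)"
  using finite_partitionwidth_if_finite_treewidth[OF assms]
    finite_partitionwidth_if_finite_cliquewidth[OF assms] by blast

end
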